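(* Let $(M,\mathcal T,I)$ be a triangulated connected closed surface with inversive distance $I\ge0$, and let $\bar K=(\bar K_1,\dots,\bar K_N)^T\in\mathbb R^N$ be a prescribed value. Consider the prescribed curvature flow $$u_i'(t)=\bar K_i-\widetilde K_i,\quad i\in V,\qquad u(0)\in\mathbb R^N .$$ (1) The solution $u(t)$ to this flow exists for all time $t\in[0,+\infty)$. (2) If $u(t)$ converges to some $\bar u$, then $\bar K$ is admissible and is realized by $\bar u$. (3) If $\bar K$ is admissible and is realized by $\bar u$, then $u(t)$ converges to $\bar u$ exponentially fast.
   Context: $M$ is a connected closed surface with triangulation $\mathcal T=\{V,E,F\}$ (vertices, edges, faces), $V=\{1,\dots,N\}$; $\{ij\}$ denotes the edge joining $i,j$ and $\{ijk\}$ the face with vertices $i,j,k$. The inversive distance is a fixed function $I:E\to[0,+\infty)$. For $r\in\mathbb R^N_{>0}$ put $l_{ij}=\sqrt{r_i^2+r_j^2+2r_ir_jI_{ij}}$ for each edge. $\Omega\subset\mathbb R^N_{>0}$ is the set of $r$ such that for every face $\{ijk\}$ the three numbers $l_{ij},l_{jk},l_{ik}$ satisfy the three strict triangle inequalities. $\ln\Omega=\{x\in\mathbb R^N: (e^{x_1},\dots,e^{x_N})\in\Omega\}$. A metric $r$ is identified with $u$, where $u_i=\ln r_i$. For $r\in\Omega$, $\theta_i^{jk}$ is the inner angle at $i$ of the Euclidean triangle with edge lengths $l_{ij},l_{jk},l_{ik}$, and $K_i(r)=2\pi-\sum_{\{ijk\}\in F}\theta_i^{jk}$ (sum over faces containing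 $i$), $K=(K_1,\dots,K_N)^T$. $\bar K\in\mathbb R^N$ is called admissible if $\bar K\in K(\Omega)=\{K(r): r\in\Omega\}$; if $\bar K=K(\bar r)$ with $\bar r\in\Omega$, one says that $\bar K$ is realized by $\bar r$, or by the corresponding $\bar u\in\ln\Omega$ with $\bar u_i=\ln\bar r_i$. The metric $\bar r\in\Omega$ realizing an admissible $\bar K$ is unique up to a scalar multiplication. For arbitrary $r\in\mathbb R^N_{>0}$ and a face $\{ijk\}$, the generalized angles are defined by: if the strict triangle inequalities hold, $\tilde\theta_i^{jk}=\theta_i^{jk}$ (and similarly for $j,k$), the inner angle of the Euclidean triangle with these edge lengths; if $l_{jk}\ge l_{ij}+l_{ik}$, then $\tilde\theta_i^{jk}=\pi$ and $\tilde\theta_j^{ik}=\tilde\theta_k^{ij}=0$ (and similarly with the roles of $i,j,k$ permuted). The extended curvature is $\widetilde K_i=2\pi-\sum_{\{ijk\}\in F}\tilde\theta_i^{jk}$, a continuous function on $\mathbb R^N_{>0}$ extending $K_i$; as a function of $u\in\mathbb R^N$ it is evaluated at $r=(e^{u_1},\dots,e^{u_N})$. Convergence of $u(t)$ is as $t\to+\infty$; exponentially fast convergence to $\bar u$ means $\|u(t)-\bar u\|\le Ce^{-ct}$ for all $t\ge0$, for some constants $C,c>0$.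
   Formalization: In (2) a limit ū need not lie in ln Ω: K̄=K̃(ū) is shown always, admissibility and realization by ū only if ū∈ln Ω. In (3) ū is unique only up to adding c(1,…,1): u(t) converges exponentially to some ū+c(1,…,1), and to ū itself if Σū_i=Σu_i(0). *)

theory Defs
  imports "HOL-Analysis.Analysis"
begin

section \<open>Triangulated closed surfaces\<close>

text \<open>Second countability is automatic for a compact locally Euclidean space.\<close>

definition closed_surface :: "'m topology \<Rightarrow> bool" where
  "closed_surface M \<longleftrightarrow>
     topspace M \<noteq> {} \<and> compact_space M \<and> Hausdorff_space M \<and>
     (\<forall>p\<in>topspace M. \<exists>U. openin M U \<and> p \<in> U \<and>
        subtopology M U homeomorphic_space (euclidean :: (real^2) topology))"

text \<open>The vertex set \<open>V = {1, \<dots>, N}\<close> is a finite type \<open>'v\<close> with \<open>N = CARD('v)\<close>; an edge \<open>{ij}\<close> and a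
  face \<open>{ijk}\<close> are the sets of their vertices, so that \<open>E\<close> and \<open>F\<close> together with the singletons form an
  abstract simplicial complex. Its geometric realization is taken inside the standard simplex of
  \<open>\<real>\<^sup>N\<close>.\<close>

definition simplices :: "'v set set \<Rightarrow> 'v set set \<Rightarrow> 'v set set" where
  "simplices E F = range (\<lambda>i. {i}) \<union> E \<union> F"

definition realization :: "'v::finite set set \<Rightarrow> 'v set set \<Rightarrow> (real^'v) set" where
  "realization E F = (\<Union>s\<in>simplices E F. convex hull ((\<lambda>i. axis i 1) ` s))"

text \<open>For a complex realizing a surface, the clause that every vertex and every edge lies in a face
  is no restriction.\<close>

definition triangulates :: "'v::finite set set \<Rightarrow> 'v set set \<Rightarrow> 'm topology \<Rightarrow> bool" where
  "triangulates E F M \<longleftrightarrow>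
     (\<forall>e\<in>E. card e = 2) \<and> (\<forall>f\<in>F. card f = 3) \<and>
     (\<forall>f\<in>F. \<forall>e. e \<subseteq> f \<and> card e = 2 \<longrightarrow> e \<in> E) \<and>
     (\<forall>i. \<exists>f\<in>F. i \<in> f) \<and> (\<forall>e\<in>E. \<exists>f\<in>F. e \<subseteq> f) \<and>
     top_of_set (realization E F) homeomorphic_space M"


section \<open>Inversive distance circle packing metrics\<close>

text \<open>The inversive distance \<open>I\<close> is a function of edges; only its values on \<open>E\<close> are ever used.\<close>

definition edge_length :: "('v::finite set \<Rightarrow> real) \<Rightarrow> real^'v \<Rightarrow> 'v \<Rightarrow> 'v \<Rightarrow> real" where
  "edge_length I r i j = sqrt ((r $ i)\<^sup>2 + (r $ j)\<^sup>2 + 2 * r $ i * r $ j * I {i, j})"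

definition strict_triangle :: "real \<Rightarrow> real \<Rightarrow> real \<Rightarrow> bool" where
  "strict_triangle a b c \<longleftrightarrow> a < b + c \<and> b < a + c \<and> c < a + b"

definition Omega :: "'v::finite set set \<Rightarrow> ('v set \<Rightarrow> real) \<Rightarrow> (real^'v) set" where
  "Omega F I = {r. (\<forall>i. r $ i > 0) \<and>
     (\<forall>i j k. {i, j, k} \<in> F \<longrightarrow>
        strict_triangle (edge_length I r i j) (edge_length I r j k) (edge_length I r i k))}"

definition exp_vec :: "real^'v::finite \<Rightarrow> real^'v" where
  "exp_vec u = (\<chi> i. exp (u $ i))"

definition ln_Omega :: "'v::finite set set \<Rightarrow> ('v set \<Rightarrow> real) \<Rightarrow> (real^'v) set" where
  "ln_Omega F I = {u. exp_vec u \<in> Omega F I}"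


section \<open>Angles and curvatures\<close>

text \<open>The inner angle between the sides of lengths \<open>b\<close> and \<open>c\<close>, opposite to the side of length \<open>a\<close>.\<close>

definition inner_angle :: "real \<Rightarrow> real \<Rightarrow> real \<Rightarrow> real" where
  "inner_angle b c a = arccos ((b\<^sup>2 + c\<^sup>2 - a\<^sup>2) / (2 * b * c))"

lemma inner_angle_triangle:
  fixes A B C :: "'a::euclidean_space"
  shows "inner_angle (dist A B) (dist A C) (dist B C) =
           arccos (((B - A) \<bullet> (C - A)) / (norm (B - A) * norm (C - A)))"
proof -
  have "(dist B C)\<^sup>2 = (norm ((B - A) - (C - A)))\<^sup>2"
    by (simp add: dist_norm)
  also have "\<dots> = (norm (B - A))\<^sup>2 + (norm (C - A))\<^sup>2 - 2 * ((B - A) \<bullet> (C - A))"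
    by (simp only: power2_norm_eq_inner) (simp add: inner_diff_left inner_diff_right inner_commute)
  finally have "(dist A B)\<^sup>2 + (dist A C)\<^sup>2 - (dist B C)\<^sup>2 = 2 * ((B - A) \<bullet> (C - A))"
    by (simp add: dist_norm norm_minus_commute)
  then show ?thesis
    by (simp add: inner_angle_def dist_norm norm_minus_commute mult.assoc)
qed

definition angle :: "('v::finite set \<Rightarrow> real) \<Rightarrow> real^'v \<Rightarrow> 'v \<Rightarrow> 'v \<Rightarrow> 'v \<Rightarrow> real" where
  "angle I r i j k = inner_angle (edge_length I r i j) (edge_length I r i k) (edge_length I r j k)"

text \<open>If the strict triangle inequalities fail, exactly one of the three lengths is at least the sum of
  the other two (all lengths being positive), so the last branch is the case where this is one of the
  sides adjacent to \<open>i\<close>.\<close>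

definition gen_angle :: "('v::finite set \<Rightarrow> real) \<Rightarrow> real^'v \<Rightarrow> 'v \<Rightarrow> 'v \<Rightarrow> 'v \<Rightarrow> real" where
  "gen_angle I r i j k =
     (if strict_triangle (edge_length I r i j) (edge_length I r i k) (edge_length I r j k)
        then angle I r i j k
      else if edge_length I r j k \<ge> edge_length I r i j + edge_length I r i k then pi
      else 0)"

text \<open>For a function \<open>\<theta>\<close> of ordered triples that is symmetric in its last two arguments, \<open>at_vertex \<theta> i f\<close>
  is \<open>\<theta> i j k\<close> where \<open>f = {i, j, k}\<close>.\<close>

definition at_vertex :: "('v \<Rightarrow> 'v \<Rightarrow> 'v \<Rightarrow> real) \<Rightarrow> 'v \<Rightarrow> 'v set \<Rightarrow> real" where
  "at_vertex \<theta> i f = (THE t. \<exists>j k. f = {i, j, k} \<and> j \<noteq> i \<and> k \<noteq> i \<and> j \<noteq> k \<and> t = \<theta> i j k)"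

lemma at_vertex_eq:
  assumes "\<And>i j k. \<theta> i j k = \<theta> i k j" and "i \<noteq> j" "i \<noteq> k" "j \<noteq> k"
  shows "at_vertex \<theta> i {i, j, k} = \<theta> i j k"
  unfolding at_vertex_def
proof (rule the_equality)
  show "\<exists>j' k'. {i, j, k} = {i, j', k'} \<and> j' \<noteq> i \<and> k' \<noteq> i \<and> j' \<noteq> k' \<and> \<theta> i j k = \<theta> i j' k'"
    using assms(2-4) by metis
next
  fix t
  assume "\<exists>j' k'. {i, j, k} = {i, j', k'} \<and> j' \<noteq> i \<and> k' \<noteq> i \<and> j' \<noteq> k' \<and> t = \<theta> i j' k'"
  then obtain j' k' where *: "{i, j, k} = {i, j', k'}" "j' \<noteq> i" "k' \<noteq> i" "j' \<noteq> k'" "t = \<theta> i j' k'"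
    by blast
  then have "(j' = j \<and> k' = k) \<or> (j' = k \<and> k' = j)"
    using assms(2-4) by blast
  then show "t = \<theta> i j k"
    using assms(1) *(5) by metis
qed

lemma edge_length_commute: "edge_length I r i j = edge_length I r j i"
  by (simp add: edge_length_def insert_commute algebra_simps)

lemma angle_commute: "angle I r i j k = angle I r i k j"
  by (simp add: angle_def inner_angle_def edge_length_commute[of I r j k] algebra_simps)

lemma gen_angle_commute: "gen_angle I r i j k = gen_angle I r i k j"
  by (simp add: gen_angle_def strict_triangle_def angle_commute[of I r i j k]
      edge_length_commute[of I r j k] add.commute conj_commute conj_left_commute)

definition curvature :: "'v::finite set set \<Rightarrow> ('v set \<Rightarrow> real) \<Rightarrow> real^'v \<Rightarrow> real^'v" where
  "curvature F I r = (\<chi> i. 2 * pi - (\<Sum>f\<in>{f\<in>F. i \<in> f}. at_vertex (angle I r) i f))"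

definition ext_curvature :: "'v::finite set set \<Rightarrow> ('v set \<Rightarrow> real) \<Rightarrow> real^'v \<Rightarrow> real^'v" where
  "ext_curvature F I r = (\<chi> i. 2 * pi - (\<Sum>f\<in>{f\<in>F. i \<in> f}. at_vertex (gen_angle I r) i f))"

definition admissible :: "'v::finite set set \<Rightarrow> ('v set \<Rightarrow> real) \<Rightarrow> real^'v \<Rightarrow> bool" where
  "admissible F I Kbar \<longleftrightarrow> Kbar \<in> curvature F I ` Omega F I"

definition realized_by :: "'v::finite set set \<Rightarrow> ('v set \<Rightarrow> real) \<Rightarrow> real^'v \<Rightarrow> real^'v \<Rightarrow> bool" where
  "realized_by F I Kbar u \<longleftrightarrow> u \<in> ln_Omega F I \<and> Kbar = curvature F I (exp_vec u)"


section \<open>The extended prescribed curvature flow\<close>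

text \<open>\<open>J\<close> is the time interval; the derivative is one-sided at an end point of \<open>J\<close>.\<close>

definition flow_solution ::
    "'v::finite set set \<Rightarrow> ('v set \<Rightarrow> real) \<Rightarrow> real^'v \<Rightarrow> real set \<Rightarrow> (real \<Rightarrow> real^'v) \<Rightarrow> bool" where
  "flow_solution F I Kbar J u \<longleftrightarrow>
     (\<forall>t\<in>J. (u has_vector_derivative (Kbar - ext_curvature F I (exp_vec (u t)))) (at t within J))"

definition exp_converges :: "(real \<Rightarrow> 'a::real_normed_vector) \<Rightarrow> 'a \<Rightarrow> bool" where
  "exp_converges u a \<longleftrightarrow> (\<exists>C>0. \<exists>c>0. \<forall>t\<ge>0. norm (u t - a) \<le> C * exp (- c * t))"

end

theory Submission
  imports Defs
begin

text \<open>Write \<open>G u = Kbar - K(u)\<close> for the velocity field of the flow, \<open>K\<close> being the extended curvature in the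
  coordinates \<open>u\<^sub>i = ln r\<^sub>i\<close>. Everything rests on one inequality: \<open>G\<close> is dissipative, that is
  \<open>(G u - G v) \<bullet> (u - v) \<le> 0\<close>, and strictly so, to second order, at a nondegenerate point in the
  directions orthogonal to \<open>(1, \<dots>, 1)\<close>.

  \<^emph>\<open>Dissipativity.\<close> \<open>G\<close> is a constant plus a sum over the faces of the vectors \<open>face_angles\<close> of generalized
  angles, so one face suffices. Where the triangle inequalities hold, the derivative of the three angles
  is minus a weighted graph Laplacian of the triangle, the weight of an edge being \<open>h / l\<close> with \<open>l\<close> its
  length and \<open>h\<close> the signed distance to it from the power center of the three vertex circles. Single
  weights may be negative, but the quadratic form is nonnegative with only the constant vectors as null
  vectors, because \<open>I \<ge> 0\<close> forces the power center to lie inside the circumcircle of the triangle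
  (\<open>edge_weight_form_pos\<close>). Along a segment that passes through degenerate triangles the angles are
  continuous, being \<open>arccos\<close> of a cosine clamped to \<open>[-1, 1]\<close>, and on the degenerate part they take
  only the values \<open>0\<close> and \<open>\<pi>\<close>; a continuous function that decreases wherever its value avoids a finite
  set decreases (\<open>nonincreasing_off_finitely_many_values\<close>). Hence \<open>face_angles_antimonotone\<close>.

  \<^emph>\<open>Existence.\<close> \<open>G\<close> is continuous and bounded but not Lipschitz near degenerate triangles, so the usual
  contraction argument is not applicable. Dissipativity replaces the Lipschitz bound: the solutions of the delay equations
  \<open>u'(t) = G (u (t - h))\<close>, obtained by plain integration, form a Cauchy sequence as \<open>h \<rightarrow> 0\<close>, and their
  limit solves the flow for all times (\<open>global_solution_exists\<close>). Dissipativity also gives uniqueness, so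
  that a solution on \<open>[0, T)\<close> is the restriction of a global one.

  \<^emph>\<open>Limits.\<close> If \<open>u(t)\<close> converges to \<open>a\<close> then its velocity converges to \<open>G a\<close>, which must vanish.

  \<^emph>\<open>Exponential convergence.\<close> The angles of a face sum to \<open>\<pi>\<close>, so the sum of the coordinates of \<open>G\<close> is
  constant, and zero as soon as \<open>G\<close> has a zero; hence \<open>\<Sum> u\<^sub>i\<close> is conserved. Let \<open>a\<close> realize \<open>Kbar\<close> with the same
  coordinate sum as \<open>u(0)\<close>. As the surface is connected, the null vectors of the derivative of \<open>G\<close> at \<open>a\<close>
  are the constant vectors, so \<open>G (a + w) \<bullet> w \<le> - c |w|\<^sup>2\<close> for small \<open>w\<close> with \<open>\<Sum> w\<^sub>i = 0\<close>; dissipativity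
  along rays extends this, with a smaller \<open>c\<close>, to all \<open>w\<close> with \<open>|w| \<le> |u(0) - a|\<close>. The differential inequality
  \<open>(|u - a|\<^sup>2)' \<le> - 2 c |u - a|\<^sup>2\<close> follows (\<open>exponential_decay_to_stable_zero\<close>).\<close>

section \<open>Positivity of the weighted Laplacian of a triangle\<close>

text \<open>If \<open>A\<close>, \<open>B\<close>, \<open>C\<close> are the squared side lengths, the right side minus the left side is
  \<open>16 * Area\<^sup>2 * (R\<^sup>2 - d\<^sup>2)\<close>, where \<open>R\<close> is the circumradius and \<open>d\<close> the distance of the power center of the
  three vertex circles (of radii \<open>x\<close>, \<open>y\<close>, \<open>z\<close>) from the circumcenter. Expanded in the \<open>I\<close>'s it has
  only nonnegative coefficients.\<close>

lemma power_center_polynomial_pos: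
  fixes x y z I1 I2 I3 :: real
  assumes "x > 0" "y > 0" "z > 0" "I1 \<ge> 0" "I2 \<ge> 0" "I3 \<ge> 0"
  defines "A \<equiv> y\<^sup>2 + z\<^sup>2 + 2 * y * z * I1" and "B \<equiv> x\<^sup>2 + z\<^sup>2 + 2 * x * z * I2"
    and "C \<equiv> x\<^sup>2 + y\<^sup>2 + 2 * x * y * I3"
  shows "A * (x\<^sup>2 - y\<^sup>2) * (x\<^sup>2 - z\<^sup>2) + B * (y\<^sup>2 - x\<^sup>2) * (y\<^sup>2 - z\<^sup>2) + C * (z\<^sup>2 - x\<^sup>2) * (z\<^sup>2 - y\<^sup>2)
      < A * B * C"
proof -
  define a b c X Y Z where "a = 2 * y * z * I1" and "b = 2 * x * z * I2" and "c = 2 * x * y * I3"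
    and "X = x\<^sup>2" and "Y = y\<^sup>2" and "Z = z\<^sup>2"
  note d = this
  have nn: "a \<ge> 0" "b \<ge> 0" "c \<ge> 0" "X > 0" "Y > 0" "Z > 0"
    using assms(1-6) by (auto simp: d)
  have "A * B * C - (A * (X - Y) * (X - Z) + B * (Y - X) * (Y - Z) + C * (Z - X) * (Z - Y))
    = 8 * X * Y * Z + 2 * a * X * (Y + Z) + 2 * b * Y * (X + Z) + 2 * c * Z * (X + Y)
      + a * b * (X + Y) + a * c * (X + Z) + b * c * (Y + Z) + a * b * c"
    unfolding A_def B_def C_def d(1-3)[symmetric] d(4-6)[symmetric] by algebra
  also have "\<dots> > 0"
    using nn by (intro add_pos_nonneg mult_pos_pos mult_nonneg_nonneg) auto
  finally show ?thesis by (simp add: d(4-6))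
qed

text \<open>The numbers \<open>Ni\<close>, \<open>Nj\<close>, \<open>Nk\<close> are, up to their sum \<open>16 * Area\<^sup>2\<close> (\<open>weight_sum_identity\<close>), the barycentric
  coordinates of the power center. The left side is \<open>A * B * C\<close> times the second elementary symmetric function
  of the edge weights \<open>Ni / A\<close>, \<open>Nj / B\<close>, \<open>Nk / C\<close>; the identity therefore reads its sign off the position
  of the power center relative to the circumcircle.\<close>

lemma weight_product_identity:
  fixes A B C X Y Z :: real
  defines "Ni \<equiv> A * (B + C - A) + Y * (A + B - C) + Z * (A + C - B) - 2 * A * X"
    and "Nj \<equiv> B * (A + C - B) + X * (A + B - C) + Z * (B + C - A) - 2 * B * Y"
    and "Nk \<equiv> C * (A + B - C) + X * (A + C - B) + Y * (B + C - A) - 2 * C * Z"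
  shows "C * Ni * Nj + A * Nj * Nk + B * Nk * Ni = (4 * B * C - (B + C - A)\<^sup>2) *
     (A * B * C - A * (X - Y) * (X - Z) - B * (Y - X) * (Y - Z) - C * (Z - X) * (Z - Y))"
  unfolding assms by algebra

lemma weight_sum_identity:
  fixes A B C X Y Z :: real
  defines "Ni \<equiv> A * (B + C - A) + Y * (A + B - C) + Z * (A + C - B) - 2 * A * X"
    and "Nj \<equiv> B * (A + C - B) + X * (A + B - C) + Z * (B + C - A) - 2 * B * Y"
    and "Nk \<equiv> C * (A + B - C) + X * (A + C - B) + Y * (B + C - A) - 2 * C * Z"
  shows "Ni + Nj + Nk = 4 * B * C - (B + C - A)\<^sup>2"
  unfolding assms by algebra

text \<open>On vectors modulo constants the form has determinant \<open>p * q + q * s + s * p > 0\<close>, so it is definite, and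
  only its sign is in question. Evaluated on the two coordinate functions of a triangle with squared sides
  \<open>A\<close>, \<open>B\<close>, \<open>C\<close> it adds up to \<open>p * A + q * B + s * C > 0\<close>, so it is positive. The proof does this by completing
  squares.\<close>

lemma triangle_laplacian_pos:
  fixes p q s A B C x y z :: real
  assumes AB: "A > 0" "B > 0" and H: "4 * B * C - (B + C - A)\<^sup>2 > 0"
    and D: "p * q + q * s + s * p > 0" and tr: "p * A + q * B + s * C > 0"
  shows "p * (y - z)\<^sup>2 + q * (x - z)\<^sup>2 + s * (x - y)\<^sup>2 \<ge> 0"
    and "p * (y - z)\<^sup>2 + q * (x - z)\<^sup>2 + s * (x - y)\<^sup>2 = 0 \<Longrightarrow> x = y \<and> y = z"
proof -
  let ?D = "p * q + q * s + s * p"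
  \<comment> \<open>The squared norm of \<open>(p + s) *\<^sub>R e - s *\<^sub>R e'\<close> for two sides \<open>e\<close>, \<open>e'\<close> of the triangle is nonnegative.\<close>
  have "4 * A * ((p + s)\<^sup>2 * A + s\<^sup>2 * B - (p + s) * s * (A + B - C))
      = (2 * A * (p + s) - s * (A + B - C))\<^sup>2 + s\<^sup>2 * (4 * B * C - (B + C - A)\<^sup>2)"
    by algebra
  also have "\<dots> \<ge> 0" using H by (intro add_nonneg_nonneg mult_nonneg_nonneg) auto
  finally have "(p + s)\<^sup>2 * A + s\<^sup>2 * B - (p + s) * s * (A + B - C) \<ge> 0"
    using AB by (simp add: zero_le_mult_iff)
  moreover have "(p + s) * (p * A + q * B + s * C) =
     ((p + s)\<^sup>2 * A + s\<^sup>2 * B - (p + s) * s * (A + B - C)) + ?D * B"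
    by algebra
  moreover have "?D * B > 0" using D AB by (intro mult_pos_pos)
  ultimately have "(p + s) * (p * A + q * B + s * C) > 0" by linarith
  then have ps: "p + s > 0" using tr by (simp add: zero_less_mult_iff)
  have sq: "(p + s) * (p * (y - z)\<^sup>2 + q * (x - z)\<^sup>2 + s * (x - y)\<^sup>2) =
     ((p + s) * (y - z) - s * (x - z))\<^sup>2 + ?D * (x - z)\<^sup>2"
    by algebra
  have "((p + s) * (y - z) - s * (x - z))\<^sup>2 + ?D * (x - z)\<^sup>2 \<ge> 0" using D by simp
  then have "(p + s) * (p * (y - z)\<^sup>2 + q * (x - z)\<^sup>2 + s * (x - y)\<^sup>2) \<ge> 0"
    by (simp only: sq)
  then show "p * (y - z)\<^sup>2 + q * (x - z)\<^sup>2 + s * (x - y)\<^sup>2 \<ge> 0"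
    using ps by (simp add: zero_le_mult_iff)
  assume "p * (y - z)\<^sup>2 + q * (x - z)\<^sup>2 + s * (x - y)\<^sup>2 = 0"
  then have 0: "((p + s) * (y - z) - s * (x - z))\<^sup>2 + ?D * (x - z)\<^sup>2 = 0"
    using sq by simp
  moreover have "?D * (x - z)\<^sup>2 \<ge> 0" using D by simp
  ultimately have "?D * (x - z)\<^sup>2 = 0" by (smt (verit) zero_le_power2)
  then have xz: "x = z" using D by simp
  then show "x = y \<and> y = z" using 0 ps by simp
qed

text \<open>\<open>8 * Area * h / l\<close> for the edge of length \<open>l = sqrt A\<close>, where \<open>h\<close> is the signed distance from that
  edge to the power center of the circles with squared radii \<open>X\<close>, \<open>Y\<close>, \<open>Z\<close> around the vertices opposite to the sides
  of squared lengths \<open>A\<close>, \<open>B\<close>, \<open>C\<close>.\<close>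

definition edge_weight :: "real \<Rightarrow> real \<Rightarrow> real \<Rightarrow> real \<Rightarrow> real \<Rightarrow> real \<Rightarrow> real" where
  "edge_weight A B C X Y Z = (A * (B + C - A) + Y * (A + B - C) + Z * (A + C - B) - 2 * A * X) / A"

lemma edge_weight_commute: "edge_weight A C B X Z Y = edge_weight A B C X Y Z"
  by (simp add: edge_weight_def algebra_simps)

lemma edge_weight_form_pos:
  fixes x y z I1 I2 I3 a b c :: real
  assumes pos: "x > 0" "y > 0" "z > 0" and I: "I1 \<ge> 0" "I2 \<ge> 0" "I3 \<ge> 0"
  defines "A \<equiv> y\<^sup>2 + z\<^sup>2 + 2 * y * z * I1" and "B \<equiv> x\<^sup>2 + z\<^sup>2 + 2 * x * z * I2"
    and "C \<equiv> x\<^sup>2 + y\<^sup>2 + 2 * x * y * I3"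
  defines "p \<equiv> edge_weight A B C (x\<^sup>2) (y\<^sup>2) (z\<^sup>2)" and "q \<equiv> edge_weight B A C (y\<^sup>2) (x\<^sup>2) (z\<^sup>2)"
    and "s \<equiv> edge_weight C A B (z\<^sup>2) (x\<^sup>2) (y\<^sup>2)"
  assumes H: "4 * B * C - (B + C - A)\<^sup>2 > 0"
  shows "p * (b - c)\<^sup>2 + q * (a - c)\<^sup>2 + s * (a - b)\<^sup>2 \<ge> 0"
    and "p * (b - c)\<^sup>2 + q * (a - c)\<^sup>2 + s * (a - b)\<^sup>2 = 0 \<Longrightarrow> a = b \<and> b = c"
proof -
  define X Y Z where "X = x\<^sup>2" and "Y = y\<^sup>2" and "Z = z\<^sup>2"
  note sq = this[symmetric]
  have ABC: "A > 0" "B > 0" "C > 0"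
    using pos I unfolding A_def B_def C_def by (auto intro!: add_pos_nonneg)
  define Ni Nj Nk where "Ni = A * (B + C - A) + Y * (A + B - C) + Z * (A + C - B) - 2 * A * X"
    and "Nj = B * (A + C - B) + X * (A + B - C) + Z * (B + C - A) - 2 * B * Y"
    and "Nk = C * (A + B - C) + X * (A + C - B) + Y * (B + C - A) - 2 * C * Z"
  note N = this
  have pqs: "p = Ni / A" "q = Nj / B" "s = Nk / C"
    unfolding p_def q_def s_def edge_weight_def N sq by (simp_all add: add.commute)
  let ?H = "4 * B * C - (B + C - A)\<^sup>2"
  let ?P = "A * B * C - A * (X - Y) * (X - Z) - B * (Y - X) * (Y - Z) - C * (Z - X) * (Z - Y)"
  have "?P > 0"
    using power_center_polynomial_pos[OF pos I] unfolding A_def B_def C_def X_def Y_def Z_def by simp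
  moreover have "p * q + q * s + s * p = (C * Ni * Nj + A * Nj * Nk + B * Nk * Ni) / (A * B * C)"
    using ABC by (simp add: pqs divide_simps)
  then have "p * q + q * s + s * p = ?H * ?P / (A * B * C)"
    unfolding N weight_product_identity .
  ultimately have D: "p * q + q * s + s * p > 0"
    using H ABC by simp
  have "p * A + q * B + s * C = Ni + Nj + Nk" using ABC by (simp add: pqs)
  then have tr: "p * A + q * B + s * C > 0"
    using H unfolding N weight_sum_identity by simp
  show "p * (b - c)\<^sup>2 + q * (a - c)\<^sup>2 + s * (a - b)\<^sup>2 \<ge> 0"
    by (rule triangle_laplacian_pos(1)[OF ABC(1,2) H D tr])
  show "a = b \<and> b = c" if "p * (b - c)\<^sup>2 + q * (a - c)\<^sup>2 + s * (a - b)\<^sup>2 = 0"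
    by (rule triangle_laplacian_pos(2)[OF ABC(1,2) H D tr that])
qed

text \<open>The left side is \<open>4 * Area\<close> times the variation of the angle opposite to the first side, by the law of cosines, when the
  squared sides vary by \<open>A'\<close>, \<open>B'\<close>, \<open>C'\<close>; these are the variations caused by changing the logarithmic radii by
  \<open>a\<close>, \<open>b\<close>, \<open>c\<close>. The right side exhibits it as a row of a weighted Laplacian.\<close>

lemma angle_variation_weights:
  fixes A B C X Y Z a b c :: real
  assumes "B \<noteq> 0" "C \<noteq> 0"
  defines "A' \<equiv> (A + Y - Z) * b + (A + Z - Y) * c" and "B' \<equiv> (B + X - Z) * a + (B + Z - X) * c"
    and "C' \<equiv> (C + X - Y) * a + (C + Y - X) * b"
  shows "A' - (A + B - C) / (2 * B) * B' - (A + C - B) / (2 * C) * C' =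
     edge_weight C A B Z X Y / 2 * (b - a) + edge_weight B A C Y X Z / 2 * (c - a)"
proof -
  define q s where "q = edge_weight B A C Y X Z" and "s = edge_weight C A B Z X Y"
  have B: "(A + B - C) / (2 * B) * (B + Z - X) = (A + Z - Y) - q / 2"
    "(A + B - C) / (2 * B) * (B + X - Z) = (A + B - C) - (A + Z - Y) + q / 2"
    using assms by (simp_all add: q_def edge_weight_def field_simps)
  have C: "(A + C - B) / (2 * C) * (C + Y - X) = (A + Y - Z) - s / 2"
    "(A + C - B) / (2 * C) * (C + X - Y) = (A + C - B) - (A + Y - Z) + s / 2"
    using assms by (simp_all add: s_def edge_weight_def field_simps)
  show ?thesis
    unfolding A'_def B'_def C'_def distrib_left mult.assoc[symmetric] B C q_def[symmetric] s_def[symmetric]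
    by (simp add: algebra_simps diff_divide_distrib)
qed

section \<open>Generalized angles of a triangle\<close>

lemma heron_factorization:
  fixes a b c :: real
  shows "4 * b\<^sup>2 * c\<^sup>2 - (b\<^sup>2 + c\<^sup>2 - a\<^sup>2)\<^sup>2 = (a + b + c) * (b + c - a) * (a + c - b) * (a + b - c)"
  by (simp add: power2_eq_square algebra_simps)

lemma heron_pos:
  assumes "strict_triangle a b c"
  shows "4 * b\<^sup>2 * c\<^sup>2 - (b\<^sup>2 + c\<^sup>2 - a\<^sup>2)\<^sup>2 > 0"
  unfolding heron_factorization
  using assms unfolding strict_triangle_def by (intro mult_pos_pos) linarith+

lemma cos_ratio_less_one:
  assumes "strict_triangle a b c" "b > 0" "c > 0"
  shows "\<bar>(b\<^sup>2 + c\<^sup>2 - a\<^sup>2) / (2 * b * c)\<bar> < 1"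
proof -
  have "(b\<^sup>2 + c\<^sup>2 - a\<^sup>2)\<^sup>2 < (2 * b * c)\<^sup>2"
    unfolding power_mult_distrib using heron_pos[OF assms(1)] by simp
  then have "\<bar>b\<^sup>2 + c\<^sup>2 - a\<^sup>2\<bar> < 2 * b * c"
    using assms(2,3) power2_less_imp_less[of "\<bar>b\<^sup>2 + c\<^sup>2 - a\<^sup>2\<bar>" "2 * b * c"] by simp
  then show ?thesis using assms(2,3) by (simp only: abs_divide) simp
qed

text \<open>One formula for the generalized angle. Clamping the cosine makes its continuity across degenerate
  triangles evident.\<close>

definition clamped_angle :: "real \<Rightarrow> real \<Rightarrow> real \<Rightarrow> real" where
  "clamped_angle b c a = arccos (max (- 1) (min 1 ((b\<^sup>2 + c\<^sup>2 - a\<^sup>2) / (2 * b * c))))"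

lemma clamped_angle_commute: "clamped_angle b c a = clamped_angle c b a"
  by (simp add: clamped_angle_def algebra_simps)

lemma clamped_angle_bounds: "0 \<le> clamped_angle b c a" "clamped_angle b c a \<le> pi"
  unfolding clamped_angle_def by (intro arccos_lbound arccos_ubound; simp)+

lemma clamped_angle_strict:
  assumes "strict_triangle a b c" "b > 0" "c > 0"
  shows "clamped_angle b c a = inner_angle b c a"
proof -
  define x where "x = (b\<^sup>2 + c\<^sup>2 - a\<^sup>2) / (2 * b * c)"
  have "\<bar>x\<bar> < 1" using cos_ratio_less_one[OF assms] by (simp only: x_def)
  then show ?thesis by (simp add: clamped_angle_def inner_angle_def flip: x_def)
qed

lemma clamped_angle_opposite_long:
  assumes "a \<ge> b + c" "b > 0" "c > 0"
  shows "clamped_angle b c a = pi"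
proof -
  have "(b + c)\<^sup>2 \<le> a\<^sup>2" using assms by (intro power_mono) auto
  then have "b\<^sup>2 + c\<^sup>2 - a\<^sup>2 \<le> - 1 * (2 * b * c)" by (simp add: power2_eq_square algebra_simps)
  then have "(b\<^sup>2 + c\<^sup>2 - a\<^sup>2) / (2 * b * c) \<le> - 1"
    using assms by (subst pos_divide_le_eq) auto
  then show ?thesis by (simp add: clamped_angle_def)
qed

lemma clamped_angle_adjacent_long:
  assumes "b \<ge> a + c" "a > 0" "b > 0" "c > 0"
  shows "clamped_angle b c a = 0"
proof -
  have "a\<^sup>2 \<le> (b - c)\<^sup>2" using assms by (intro power_mono) auto
  then have "1 * (2 * b * c) \<le> b\<^sup>2 + c\<^sup>2 - a\<^sup>2" by (simp add: power2_eq_square algebra_simps)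
  then have "1 \<le> (b\<^sup>2 + c\<^sup>2 - a\<^sup>2) / (2 * b * c)"
    using assms by (subst pos_le_divide_eq) auto
  then show ?thesis by (simp add: clamped_angle_def)
qed

lemma inner_angle_cos_sin:
  assumes "strict_triangle a b c" "b > 0" "c > 0"
  defines "H \<equiv> 4 * b\<^sup>2 * c\<^sup>2 - (b\<^sup>2 + c\<^sup>2 - a\<^sup>2)\<^sup>2"
  shows "cos (inner_angle b c a) = (b\<^sup>2 + c\<^sup>2 - a\<^sup>2) / (2 * b * c)"
    and "sin (inner_angle b c a) = sqrt H / (2 * b * c)"
    and "0 < inner_angle b c a" "inner_angle b c a < pi"
proof -
  let ?x = "(b\<^sup>2 + c\<^sup>2 - a\<^sup>2) / (2 * b * c)"
  have x: "- 1 < ?x" "?x < 1" using cos_ratio_less_one[OF assms(1-3)] by (simp_all only: abs_less_iff) simp_all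
  show "cos (inner_angle b c a) = ?x" using x by (simp add: inner_angle_def)
  have "1 - ?x\<^sup>2 = H / (2 * b * c)\<^sup>2"
  proof -
    have "1 - (n / d)\<^sup>2 = (d\<^sup>2 - n\<^sup>2) / d\<^sup>2" if "d \<noteq> 0" for n d :: real
      using that by (simp add: power_divide diff_divide_distrib)
    from this[of "2 * b * c"] show ?thesis using assms(2,3) by (simp add: H_def power_mult_distrib)
  qed
  moreover have "sqrt (H / (2 * b * c)\<^sup>2) = sqrt H / (2 * b * c)"
    using assms(2,3) by (simp only: real_sqrt_divide real_sqrt_abs) simp
  ultimately show "sin (inner_angle b c a) = sqrt H / (2 * b * c)"
    using x by (simp add: inner_angle_def sin_arccos)
  show "0 < inner_angle b c a" "inner_angle b c a < pi"
    using arccos_lt_bounded[OF x] by (auto simp: inner_angle_def)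
qed

text \<open>The sines and cosines are rational in the sides and in the square root of the common quantity
  \<open>16 * Area\<^sup>2\<close>, so the addition theorems give \<open>cos (\<alpha> + \<beta>) = cos (\<pi> - \<gamma>)\<close>; that \<open>sin (\<alpha> + \<beta>) = sin \<gamma>\<close> is positive
  excludes the other solution \<open>\<alpha> + \<beta> = \<pi> + \<gamma>\<close>.\<close>

lemma inner_angle_sum:
  assumes t: "strict_triangle a b c" and pos: "a > 0" "b > 0" "c > 0"
  shows "inner_angle b c a + inner_angle a c b + inner_angle a b c = pi"
proof -
  define H where "H = 4 * b\<^sup>2 * c\<^sup>2 - (b\<^sup>2 + c\<^sup>2 - a\<^sup>2)\<^sup>2"
  have H: "H > 0" using heron_pos[OF t] by (simp add: H_def)
  have H': "4 * a\<^sup>2 * c\<^sup>2 - (a\<^sup>2 + c\<^sup>2 - b\<^sup>2)\<^sup>2 = H" "4 * a\<^sup>2 * b\<^sup>2 - (a\<^sup>2 + b\<^sup>2 - c\<^sup>2)\<^sup>2 = H"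
    unfolding H_def by (simp_all add: power2_eq_square algebra_simps)
  define \<alpha> \<beta> \<gamma> where "\<alpha> = inner_angle b c a" and "\<beta> = inner_angle a c b" and "\<gamma> = inner_angle a b c"
  note d = this
  have tb: "strict_triangle b a c" and tc: "strict_triangle c a b"
    using t by (auto simp: strict_triangle_def)
  note \<alpha> = inner_angle_cos_sin[OF t pos(2,3), folded d H_def]
  note \<beta> = inner_angle_cos_sin[OF tb pos(1,3), unfolded H', folded d]
  note \<gamma> = inner_angle_cos_sin[OF tc pos(1,2), unfolded H', folded d]
  have s: "sqrt H * sqrt H = H" using H by simp
  have "K / (2 * b * c) * ((a\<^sup>2 + c\<^sup>2 - b\<^sup>2) / (2 * a * c)) + (b\<^sup>2 + c\<^sup>2 - a\<^sup>2) / (2 * b * c) * (K / (2 * a * c))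
      = K / (2 * a * b)" for K
  proof -
    have "K / (2 * b * c) * (x / (2 * a * c)) + y / (2 * b * c) * (K / (2 * a * c)) = K * (x + y) / (4 * a * b * c\<^sup>2)"
      for x y :: real
      by (simp add: power2_eq_square add_divide_distrib distrib_left mult.commute mult.left_commute)
    moreover have "a\<^sup>2 + c\<^sup>2 - b\<^sup>2 + (b\<^sup>2 + c\<^sup>2 - a\<^sup>2) = 2 * c\<^sup>2" by simp
    moreover have "K * (2 * c\<^sup>2) / (4 * a * b * c\<^sup>2) = K / (2 * a * b)" using pos by simp
    ultimately show ?thesis by (simp only:)
  qed
  then have "sin (\<alpha> + \<beta>) = sin \<gamma>"
    unfolding sin_add \<alpha>(1,2) \<beta>(1,2) \<gamma>(1,2) by blast
  moreover have "cos (\<alpha> + \<beta>) = - cos \<gamma>"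
  proof -
    have "cos (\<alpha> + \<beta>) = ((b\<^sup>2 + c\<^sup>2 - a\<^sup>2) * (a\<^sup>2 + c\<^sup>2 - b\<^sup>2) - sqrt H * sqrt H) / (4 * a * b * c\<^sup>2)"
    proof -
      have "x / (2 * b * c) * (y / (2 * a * c)) - z / (2 * b * c) * (z / (2 * a * c)) = (x * y - z * z) / (4 * a * b * c\<^sup>2)"
        for x y z :: real
        by (simp add: power2_eq_square diff_divide_distrib mult.commute mult.left_commute)
      then show ?thesis unfolding cos_add \<alpha>(1,2) \<beta>(1,2) by blast
    qed
    also have "(b\<^sup>2 + c\<^sup>2 - a\<^sup>2) * (a\<^sup>2 + c\<^sup>2 - b\<^sup>2) - sqrt H * sqrt H = - 2 * c\<^sup>2 * (a\<^sup>2 + b\<^sup>2 - c\<^sup>2)"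
      unfolding s unfolding H_def by (simp add: power2_eq_square algebra_simps)
    also have "\<dots> / (4 * a * b * c\<^sup>2) = - cos \<gamma>"
      unfolding \<gamma>(1) using pos by (simp add: field_simps power2_eq_square)
    finally show ?thesis .
  qed
  moreover have "sin \<gamma> > 0" using \<gamma>(2) pos H by simp
  ultimately have *: "sin (\<alpha> + \<beta>) > 0" "cos (\<alpha> + \<beta>) = cos (pi - \<gamma>)" by auto
  have "\<alpha> + \<beta> < pi"
  proof (rule ccontr)
    assume "\<not> \<alpha> + \<beta> < pi"
    then have "sin (\<alpha> + \<beta>) \<le> 0" using \<alpha>(4) \<beta>(4) by (intro sin_le_zero) auto
    then show False using * by simp
  qed
  then have "\<alpha> + \<beta> = pi - \<gamma>"
    using \<alpha>(3) \<beta>(3) \<gamma>(3,4) *(2) using cos_inj_pi[of "\<alpha> + \<beta>" "pi - \<gamma>"] by simp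
  then show ?thesis by (simp add: d)
qed

lemma clamped_angle_sum:
  assumes pos: "a > 0" "b > 0" "c > 0"
  shows "clamped_angle b c a + clamped_angle a c b + clamped_angle a b c = pi"
proof -
  consider "strict_triangle a b c" | "a \<ge> b + c" | "b \<ge> a + c" | "c \<ge> a + b"
    unfolding strict_triangle_def by linarith
  then show ?thesis
  proof cases
    case 1
    then have "strict_triangle b a c" "strict_triangle c a b" by (auto simp: strict_triangle_def)
    then show ?thesis using 1 pos inner_angle_sum[OF 1 pos] by (simp add: clamped_angle_strict)
  next
    case 2
    then show ?thesis using pos
      by (simp add: clamped_angle_opposite_long clamped_angle_adjacent_long add.commute)
  next
    case 3
    have "clamped_angle b c a = 0" using 3 pos by (intro clamped_angle_adjacent_long)
    moreover have "clamped_angle a c b = pi" using 3 pos by (intro clamped_angle_opposite_long)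
    moreover have "clamped_angle b a c = 0" using 3 pos by (intro clamped_angle_adjacent_long) auto
    ultimately show ?thesis by (simp add: clamped_angle_commute[of b a c])
  next
    case 4
    have "clamped_angle c b a = 0" using 4 pos by (intro clamped_angle_adjacent_long) auto
    moreover have "clamped_angle a b c = pi" using 4 pos by (intro clamped_angle_opposite_long)
    moreover have "clamped_angle c a b = 0" using 4 pos by (intro clamped_angle_adjacent_long) auto
    ultimately show ?thesis by (simp add: clamped_angle_commute[of c b a] clamped_angle_commute[of c a b])
  qed
qed

text \<open>Near a nondegenerate triangle the clamping is inactive, and this is the differentiated law of cosines
  in terms of the squared sides.\<close>

lemma has_derivative_clamped_angle:
  fixes A B C :: "'a::real_normed_vector \<Rightarrow> real"
  assumes A: "(A has_derivative A') (at u)" and B: "(B has_derivative B') (at u)"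
    and C: "(C has_derivative C') (at u)"
    and pos: "A u > 0" "B u > 0" "C u > 0"
    and t: "strict_triangle (sqrt (A u)) (sqrt (B u)) (sqrt (C u))"
  defines "H \<equiv> 4 * B u * C u - (B u + C u - A u)\<^sup>2"
  shows "((\<lambda>x. clamped_angle (sqrt (B x)) (sqrt (C x)) (sqrt (A x))) has_derivative
     (\<lambda>w. (A' w - (A u + B u - C u) / (2 * B u) * B' w - (A u + C u - B u) / (2 * C u) * C' w)
           / sqrt H)) (at u)"
proof -
  define R where "R = (\<lambda>x. (B x + C x - A x) / (2 * (sqrt (B x) * sqrt (C x))))"
  have Ru: "- 1 < R u" "R u < 1"
    using cos_ratio_less_one[OF t] pos by (simp_all only: abs_less_iff R_def) (simp_all add: mult.assoc)
  have H: "H > 0" using heron_pos[OF t] pos by (simp add: H_def)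
  have s: "sqrt (B u) * sqrt (B u) = B u" "sqrt (C u) * sqrt (C u) = C u" using pos by auto
  have s0: "sqrt (B u) > 0" "sqrt (C u) > 0" using pos by auto
  define R' where "R' = (\<lambda>w. (B' w + C' w - A' w) / (2 * (sqrt (B u) * sqrt (C u)))
      - (B u + C u - A u) * (C u * B' w + B u * C' w) / (4 * (B u * C u) * (sqrt (B u) * sqrt (C u))))"
  have R: "(R has_derivative R') (at u)"
    unfolding R_def R'_def
  proof -
    define m where "m = sqrt (B u) * sqrt (C u)"
    have m: "m > 0" using s0 by (simp add: m_def)
    have r: "((\<lambda>x. B x + C x - A x) has_derivative (\<lambda>w. B' w + C' w - A' w)) (at u)"
      by (intro has_derivative_diff has_derivative_add A B C)
    have q: "((\<lambda>x. 2 * (sqrt (B x) * sqrt (C x))) has_derivative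
        (\<lambda>w. 2 * (sqrt (B u) * (C' w * (inverse (sqrt (C u)) / 2)) + B' w * (inverse (sqrt (B u)) / 2) * sqrt (C u)))) (at u)"
      by (intro has_derivative_mult_right has_derivative_mult has_derivative_real_sqrt B C pos)
    show "((\<lambda>x. (B x + C x - A x) / (2 * (sqrt (B x) * sqrt (C x)))) has_derivative
      (\<lambda>w. (B' w + C' w - A' w) / (2 * (sqrt (B u) * sqrt (C u)))
      - (B u + C u - A u) * (C u * B' w + B u * C' w) / (4 * (B u * C u) * (sqrt (B u) * sqrt (C u))))) (at u)"
    proof (rule has_derivative_eq_rhs[OF has_derivative_divide'[OF r q]])
      show "2 * (sqrt (B u) * sqrt (C u)) \<noteq> 0" using s0 by simp
      have e: "2 * (sqrt (B u) * (C' w * (inverse (sqrt (C u)) / 2)) + B' w * (inverse (sqrt (B u)) / 2) * sqrt (C u))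
          = (C u * B' w + B u * C' w) / m" for w
      proof -
        have "inverse (sqrt (C u)) = sqrt (B u) / m" "inverse (sqrt (B u)) = sqrt (C u) / m"
          using s0 by (simp_all add: m_def divide_simps)
        then have "2 * (sqrt (B u) * (C' w * (inverse (sqrt (C u)) / 2)) + B' w * (inverse (sqrt (B u)) / 2) * sqrt (C u))
           = (sqrt (C u) * sqrt (C u) * B' w + sqrt (B u) * sqrt (B u) * C' w) / m"
        proof -
          have "2 * (x * (c * (y' / 2)) + b * (x' / 2) * y) = (y * y * b + x * x * c) / m"
            if "y' = x / m" "x' = y / m" for x y x' y' b c :: real
            using that by (simp add: add_divide_distrib ac_simps)
          with \<open>inverse (sqrt (C u)) = _\<close> \<open>inverse (sqrt (B u)) = _\<close> show ?thesis by blast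
        qed
        then show ?thesis by (simp only: s)
      qed
      have "m * m = (sqrt (B u) * sqrt (B u)) * (sqrt (C u) * sqrt (C u))"
        unfolding m_def by (simp only: ac_simps)
      then have mm: "m * m = B u * C u" by (simp only: s)
      have frac: "(n * (2 * m) - k * (e / m)) / (2 * m * (2 * m)) = n / (2 * m) - k * e / (4 * (m * m) * m)"
        for n k e :: real
        using m by (simp add: diff_divide_distrib)
      show "(\<lambda>w. ((B' w + C' w - A' w) * (2 * (sqrt (B u) * sqrt (C u))) - (B u + C u - A u) *
          (2 * (sqrt (B u) * (C' w * (inverse (sqrt (C u)) / 2)) + B' w * (inverse (sqrt (B u)) / 2) * sqrt (C u)))) /
          (2 * (sqrt (B u) * sqrt (C u)) * (2 * (sqrt (B u) * sqrt (C u))))) =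
        (\<lambda>w. (B' w + C' w - A' w) / (2 * (sqrt (B u) * sqrt (C u)))
          - (B u + C u - A u) * (C u * B' w + B u * C' w) / (4 * (B u * C u) * (sqrt (B u) * sqrt (C u))))"
        unfolding e unfolding m_def[symmetric] mm[symmetric] frac by (rule refl)
    qed
  qed
  have ev: "\<forall>\<^sub>F x in at u. arccos (R x) = clamped_angle (sqrt (B x)) (sqrt (C x)) (sqrt (A x))"
  proof -
    have c: "(A \<longlongrightarrow> A u) (at u)" "(B \<longlongrightarrow> B u) (at u)" "(C \<longlongrightarrow> C u) (at u)" "(R \<longlongrightarrow> R u) (at u)"
      using A B C R has_derivative_continuous isCont_def by blast+
    have "\<forall>\<^sub>F x in at u. 0 < A x" "\<forall>\<^sub>F x in at u. 0 < B x" "\<forall>\<^sub>F x in at u. 0 < C x"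
       "\<forall>\<^sub>F x in at u. - 1 < R x" "\<forall>\<^sub>F x in at u. R x < 1"
      using order_tendstoD(1)[OF c(1) pos(1)] order_tendstoD(1)[OF c(2) pos(2)]
        order_tendstoD(1)[OF c(3) pos(3)] order_tendstoD[OF c(4)] Ru by blast+
    then show ?thesis
      by eventually_elim (simp add: clamped_angle_def R_def mult.assoc)
  qed
  have at: "arccos (R u) = clamped_angle (sqrt (B u)) (sqrt (C u)) (sqrt (A u))"
    using Ru pos by (simp add: clamped_angle_def R_def mult.assoc)
  have "1 - (R u)\<^sup>2 = H / (2 * (sqrt (B u) * sqrt (C u)))\<^sup>2"
    using pos by (simp add: H_def R_def field_simps)
  moreover have "sqrt (H / (2 * (sqrt (B u) * sqrt (C u)))\<^sup>2) = sqrt H / (2 * (sqrt (B u) * sqrt (C u)))"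
    using s0 by (simp only: real_sqrt_divide real_sqrt_abs) simp
  ultimately have sq: "sqrt (1 - (R u)\<^sup>2) = sqrt H / (2 * (sqrt (B u) * sqrt (C u)))" by simp
  have der: "((\<lambda>x. arccos (R x)) has_derivative (\<lambda>w. R' w * inverse (- sqrt (1 - (R u)\<^sup>2)))) (at u)"
    by (rule has_derivative_arccos[OF Ru R])
  have eq: "R' w * inverse (- sqrt (1 - (R u)\<^sup>2)) =
    (A' w - (A u + B u - C u) / (2 * B u) * B' w - (A u + C u - B u) / (2 * C u) * C' w) / sqrt H" for w
  proof -
    define m where "m = sqrt (B u) * sqrt (C u)"
    have m: "m > 0" using s0 by (simp add: m_def)
    have "R' w * inverse (- sqrt (1 - (R u)\<^sup>2)) = - (R' w * (2 * m)) / sqrt H"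
      unfolding sq m_def[symmetric] by (simp add: inverse_eq_divide)
    moreover have "R' w * (2 * m) = (B' w + C' w - A' w)
        - (B u + C u - A u) * (C u * B' w + B u * C' w) / (2 * (B u * C u))"
    proof -
      have "(n / (2 * m) - k * e / (4 * p * m)) * (2 * m) = n - k * e / (2 * p)" for n k e p :: real
        using m by (cases "p = 0") (simp_all add: field_simps)
      then show ?thesis unfolding R'_def m_def[symmetric] by blast
    qed
    moreover have "- ((B' w + C' w - A' w)
        - (B u + C u - A u) * (C u * B' w + B u * C' w) / (2 * (B u * C u))) = A' w - (A u + B u - C u) / (2 * B u) * B' w - (A u + C u - B u) / (2 * C u) * C' w"
    proof -
      define k where "k = B u + C u - A u"
      have k: "(A u + B u - C u) / (2 * B u) = 1 - k / (2 * B u)" "(A u + C u - B u) / (2 * C u) = 1 - k / (2 * C u)"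
        using pos by (simp_all add: k_def field_simps)
      have e: "k * (C u * B' w + B u * C' w) / (2 * (B u * C u)) = k / (2 * B u) * B' w + k / (2 * C u) * C' w"
        using pos by (simp add: field_simps)
      show ?thesis unfolding k k_def[symmetric] e by (simp only: left_diff_distrib)
    qed
    ultimately show ?thesis by (simp only:)
  qed
  show ?thesis
    using has_derivative_transform_eventually[OF der ev at UNIV_I] unfolding eq .
qed

section \<open>Monotonicity of the angles of a face\<close>

text \<open>This avoids all analysis of the set of parameters at which a triangle degenerates, which may be
  complicated. If \<open>g a < g b\<close>, some interval of values between them avoids \<open>Y\<close>; \<open>g\<close> climbs through it on a
  parameter interval on which \<open>g\<close> is differentiable with nonpositive derivative.\<close>

lemma nonincreasing_off_finitely_many_values:
  fixes g :: "real \<Rightarrow> real"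
  assumes "a \<le> b" and cont: "continuous_on {a..b} g" and Y: "finite Y"
    and der: "\<And>s. a < s \<Longrightarrow> s < b \<Longrightarrow> g s \<notin> Y \<Longrightarrow> \<exists>d\<le>0. (g has_real_derivative d) (at s)"
  shows "g b \<le> g a"
proof (rule ccontr)
  assume "\<not> g b \<le> g a"
  then have ab: "g a < g b" by simp
  \<comment> \<open>The values strictly between \<open>g a\<close> and \<open>m\<close> avoid \<open>Y\<close>.\<close>
  define m where "m = Min (insert (g b) {y\<in>Y. g a < y})"
  have fin: "finite (insert (g b) {y\<in>Y. g a < y})" using Y by simp
  have m: "g a < m" "m \<le> g b"
    unfolding m_def using fin ab by (auto simp: Min_gr_iff)
  have free: "y \<notin> Y" if "g a < y" "y < m" for y
    using that Min_le[OF fin, of y] unfolding m_def by auto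
  obtain y1 where y1: "g a < y1" "y1 < m" using dense m(1) by blast
  obtain y2 where y2: "y1 < y2" "y2 < m" using dense y1(2) by blast
  \<comment> \<open>The first parameter \<open>s2\<close> at which \<open>g\<close> reaches \<open>y2\<close>, and before it the last \<open>s1\<close> with a value at most \<open>y1\<close>.\<close>
  define S2 where "S2 = {a..b} \<inter> g -` {y2..}"
  have "closed S2" unfolding S2_def
    by (rule continuous_closed_preimage[OF cont]) auto
  then have c2: "compact S2"
    using bounded_subset[of "{a..b}" S2] by (auto simp: S2_def compact_eq_bounded_closed)
  have "S2 \<noteq> {}" using m(2) y2 \<open>a \<le> b\<close> by (auto simp: S2_def)
  then obtain s2 where s2: "s2 \<in> S2" "\<And>s. s \<in> S2 \<Longrightarrow> s2 \<le> s"
    using compact_attains_inf[OF c2] by auto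
  have s2ab: "a \<le> s2" "s2 \<le> b" "g s2 \<ge> y2" using s2(1) by (auto simp: S2_def)
  have before: "g s < y2" if "a \<le> s" "s < s2" for s
    using s2(2)[of s] that s2ab by (force simp: S2_def)
  define S1 where "S1 = {a..s2} \<inter> g -` {..y1}"
  have cont1: "continuous_on {a..s2} g" using cont s2ab by (auto intro: continuous_on_subset)
  have "closed S1" unfolding S1_def
    by (rule continuous_closed_preimage[OF cont1]) auto
  then have c1: "compact S1"
    using bounded_subset[of "{a..s2}" S1] by (auto simp: S1_def compact_eq_bounded_closed)
  have "S1 \<noteq> {}" using y1 s2ab by (auto simp: S1_def)
  then obtain s1 where s1: "s1 \<in> S1" "\<And>s. s \<in> S1 \<Longrightarrow> s \<le> s1"
    using compact_attains_sup[OF c1] by auto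
  have s1ab: "a \<le> s1" "s1 \<le> s2" "g s1 \<le> y1" using s1(1) by (auto simp: S1_def)
  have "s1 \<noteq> s2" using s1ab s2ab y2 by auto
  then have lt: "s1 < s2" using s1ab by simp
  have after: "y1 < g s" if "s1 < s" "s \<le> s2" for s
    using s1(2)[of s] that s1ab by (force simp: S1_def)
  have "g s2 \<le> g s1"
  proof (rule DERIV_nonpos_imp_decreasing_open[OF s1ab(2)])
    fix s assume s: "s1 < s" "s < s2"
    have "g s \<notin> Y" using free[of "g s"] after[of s] before[of s] s y1 y2 s1ab by auto
    then show "\<exists>y. (g has_real_derivative y) (at s) \<and> y \<le> 0"
      using der[of s] s s1ab s2ab by auto
  next
    show "continuous_on {s1..s2} g" using cont1 s1ab by (auto intro: continuous_on_subset)
  qed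
  then show False using s1ab s2ab y2 by linarith
qed

definition sq_length :: "('v::finite set \<Rightarrow> real) \<Rightarrow> real^'v \<Rightarrow> 'v \<Rightarrow> 'v \<Rightarrow> real" where
  "sq_length I u i j = (exp (u $ i))\<^sup>2 + (exp (u $ j))\<^sup>2 + 2 * exp (u $ i) * exp (u $ j) * I {i, j}"

lemma sq_length_commute: "sq_length I u i j = sq_length I u j i"
  by (simp add: sq_length_def insert_commute)

lemma edge_length_exp_vec: "edge_length I (exp_vec u) i j = sqrt (sq_length I u i j)"
  by (simp add: edge_length_def exp_vec_def sq_length_def)

lemma sq_length_pos: "I {i, j} \<ge> 0 \<Longrightarrow> sq_length I u i j > 0"
  unfolding sq_length_def by (intro add_pos_nonneg mult_nonneg_nonneg) auto

lemma has_derivative_sq_length: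
  "((\<lambda>u. sq_length I u i j) has_derivative
     (\<lambda>w. (sq_length I u i j + (exp (u $ i))\<^sup>2 - (exp (u $ j))\<^sup>2) * w $ i
        + (sq_length I u i j + (exp (u $ j))\<^sup>2 - (exp (u $ i))\<^sup>2) * w $ j)) (at u)"
  unfolding sq_length_def
  by (rule derivative_eq_intros bounded_linear.has_derivative[OF bounded_linear_vec_nth] refl)+
     (simp add: fun_eq_iff power2_eq_square algebra_simps)

lemma continuous_sq_length: "continuous_on S (\<lambda>u. sq_length I u i j)"
  unfolding sq_length_def by (intro continuous_intros)

text \<open>The contribution of the face \<open>f\<close> to the curvature, as a vector supported on the vertices of \<open>f\<close>.\<close>

definition face_angles :: "('v::finite set \<Rightarrow> real) \<Rightarrow> real^'v \<Rightarrow> 'v set \<Rightarrow> real^'v" where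
  "face_angles I u f = (\<Sum>i\<in>f. at_vertex (gen_angle I (exp_vec u)) i f *\<^sub>R axis i 1)"

definition nonneg_face :: "('v set \<Rightarrow> real) \<Rightarrow> 'v \<Rightarrow> 'v \<Rightarrow> 'v \<Rightarrow> bool" where
  "nonneg_face I i j k \<longleftrightarrow> I {i, j} \<ge> 0 \<and> I {i, k} \<ge> 0 \<and> I {j, k} \<ge> 0"

lemma nonneg_face_rotate: "nonneg_face I i j k \<Longrightarrow> nonneg_face I j i k \<and> nonneg_face I k i j"
  by (auto simp: nonneg_face_def insert_commute)

lemma sq_length_face_pos:
  assumes "nonneg_face I i j k"
  shows "sq_length I u i j > 0" "sq_length I u i k > 0" "sq_length I u j k > 0"
  using assms by (auto simp: nonneg_face_def intro: sq_length_pos)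

definition face_angle :: "('v::finite set \<Rightarrow> real) \<Rightarrow> 'v \<Rightarrow> 'v \<Rightarrow> 'v \<Rightarrow> real^'v \<Rightarrow> real" where
  "face_angle I i j k u =
     clamped_angle (sqrt (sq_length I u i k)) (sqrt (sq_length I u i j)) (sqrt (sq_length I u j k))"

definition nondegenerate :: "('v::finite set \<Rightarrow> real) \<Rightarrow> 'v \<Rightarrow> 'v \<Rightarrow> 'v \<Rightarrow> real^'v \<Rightarrow> bool" where
  "nondegenerate I i j k u \<longleftrightarrow>
     strict_triangle (sqrt (sq_length I u j k)) (sqrt (sq_length I u i k)) (sqrt (sq_length I u i j))"

lemma nondegenerate_rotate:
  "nondegenerate I i j k u \<Longrightarrow> nondegenerate I j i k u \<and> nondegenerate I k i j u"
  by (auto simp: nondegenerate_def strict_triangle_def sq_length_commute[of I u j i]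
    sq_length_commute[of I u k i] sq_length_commute[of I u k j])

lemma gen_angle_eq_face_angle:
  assumes "nonneg_face I i j k"
  shows "gen_angle I (exp_vec u) i j k = face_angle I i j k u"
proof -
  define a b c where "a = sqrt (sq_length I u j k)" and "b = sqrt (sq_length I u i k)"
    and "c = sqrt (sq_length I u i j)"
  note d = this
  have pos: "a > 0" "b > 0" "c > 0" using sq_length_face_pos[OF assms] by (simp_all add: d)
  have "gen_angle I (exp_vec u) i j k =
      (if strict_triangle c b a then inner_angle c b a else if a \<ge> c + b then pi else 0)"
    unfolding gen_angle_def angle_def edge_length_exp_vec d ..
  also have "\<dots> = clamped_angle c b a"
  proof -
    have "strict_triangle c b a \<Longrightarrow> strict_triangle a c b" by (auto simp: strict_triangle_def)
    moreover have "clamped_angle c b a = 0" if "\<not> strict_triangle c b a" "\<not> a \<ge> c + b"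
    proof -
      have "c \<ge> a + b \<or> b \<ge> a + c" using that unfolding strict_triangle_def by linarith
      then show ?thesis
      proof
        assume "c \<ge> a + b"
        then show ?thesis using pos by (intro clamped_angle_adjacent_long)
      next
        assume "b \<ge> a + c"
        then have "clamped_angle b c a = 0" using pos by (intro clamped_angle_adjacent_long)
        then show ?thesis by (simp add: clamped_angle_commute)
      qed
    qed
    ultimately show ?thesis using pos clamped_angle_strict clamped_angle_opposite_long by auto
  qed
  finally show ?thesis by (simp add: face_angle_def d clamped_angle_commute)
qed

lemma continuous_face_angle:
  assumes "nonneg_face I i j k"
  shows "continuous_on S (face_angle I i j k)"
  unfolding face_angle_def clamped_angle_def
proof (intro continuous_intros continuous_sq_length)
  show "\<forall>u\<in>S. 2 * sqrt (sq_length I u i k) * sqrt (sq_length I u i j) \<noteq> 0"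
    using sq_length_face_pos[OF assms]
    by (metis less_irrefl mult_eq_0_iff real_sqrt_eq_zero_cancel_iff zero_neq_numeral)
qed auto

lemma face_angle_bounds: "0 \<le> face_angle I i j k u" "face_angle I i j k u \<le> pi"
  by (simp_all add: face_angle_def clamped_angle_bounds)

lemma face_angle_sum:
  assumes "nonneg_face I i j k"
  shows "face_angle I i j k u + face_angle I j i k u + face_angle I k i j u = pi"
  using clamped_angle_sum[of "sqrt (sq_length I u j k)" "sqrt (sq_length I u i k)" "sqrt (sq_length I u i j)"]
    sq_length_face_pos[OF assms, of u]
  by (simp add: face_angle_def sq_length_commute[of I u j i]
    sq_length_commute[of I u k i] sq_length_commute[of I u k j] clamped_angle_commute)

lemma face_angle_degenerate:
  assumes "nonneg_face I i j k" "\<not> nondegenerate I i j k u"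
  shows "face_angle I i j k u \<in> {0, pi}"
proof -
  define a b c where "a = sqrt (sq_length I u j k)" and "b = sqrt (sq_length I u i k)"
    and "c = sqrt (sq_length I u i j)"
  note d = this
  have pos: "a > 0" "b > 0" "c > 0" using sq_length_face_pos[OF assms(1)] by (simp_all add: d)
  have th: "face_angle I i j k u = clamped_angle b c a" by (simp add: face_angle_def d)
  consider "a \<ge> b + c" | "b \<ge> a + c" | "c \<ge> a + b"
    using assms(2) unfolding nondegenerate_def d[symmetric] strict_triangle_def by linarith
  then show ?thesis
  proof cases
    case 1
    then show ?thesis using pos by (simp add: th clamped_angle_opposite_long)
  next
    case 2
    then show ?thesis using pos by (simp add: th clamped_angle_adjacent_long)
  next
    case 3
    then have "clamped_angle c b a = 0" using pos by (intro clamped_angle_adjacent_long)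
    then show ?thesis by (simp add: th clamped_angle_commute[of b])
  qed
qed

definition face_heron :: "('v::finite set \<Rightarrow> real) \<Rightarrow> 'v \<Rightarrow> 'v \<Rightarrow> 'v \<Rightarrow> real^'v \<Rightarrow> real" where
  "face_heron I i j k u = 4 * sq_length I u i k * sq_length I u i j
     - (sq_length I u i k + sq_length I u i j - sq_length I u j k)\<^sup>2"

lemma face_heron_rotate:
  "face_heron I j i k u = face_heron I i j k u" "face_heron I k i j u = face_heron I i j k u"
  by (simp_all add: face_heron_def sq_length_commute[of I u j i]
    sq_length_commute[of I u k i] sq_length_commute[of I u k j] power2_eq_square algebra_simps)

lemma face_heron_pos:
  assumes "nonneg_face I i j k" "nondegenerate I i j k u"
  shows "face_heron I i j k u > 0"
  using heron_pos[OF assms(2)[unfolded nondegenerate_def]] sq_length_face_pos[OF assms(1), of u]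
  by (simp add: face_heron_def less_imp_le)

definition face_weight :: "('v::finite set \<Rightarrow> real) \<Rightarrow> 'v \<Rightarrow> 'v \<Rightarrow> 'v \<Rightarrow> real^'v \<Rightarrow> real" where
  "face_weight I i j k u = edge_weight (sq_length I u j k) (sq_length I u i k) (sq_length I u i j)
     ((exp (u $ i))\<^sup>2) ((exp (u $ j))\<^sup>2) ((exp (u $ k))\<^sup>2)"

lemma face_weight_commute: "face_weight I i k j u = face_weight I i j k u"
  by (simp add: face_weight_def edge_weight_commute sq_length_commute[of I u k j])

lemma has_derivative_face_angle:
  assumes "nonneg_face I i j k" "nondegenerate I i j k u"
  shows "(face_angle I i j k has_derivative
     (\<lambda>w. (face_weight I k i j u / 2 * (w $ j - w $ i) + face_weight I j i k u / 2 * (w $ k - w $ i))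
            / sqrt (face_heron I i j k u))) (at u)"
proof -
  note pos = sq_length_face_pos[OF assms(1), of u]
  have w: "face_weight I k i j u = edge_weight (sq_length I u i j) (sq_length I u j k) (sq_length I u i k)
      ((exp (u $ k))\<^sup>2) ((exp (u $ i))\<^sup>2) ((exp (u $ j))\<^sup>2)"
    "face_weight I j i k u = edge_weight (sq_length I u i k) (sq_length I u j k) (sq_length I u i j)
      ((exp (u $ j))\<^sup>2) ((exp (u $ i))\<^sup>2) ((exp (u $ k))\<^sup>2)"
    by (simp_all add: face_weight_def sq_length_commute[of I u j i]
      sq_length_commute[of I u k i] sq_length_commute[of I u k j])
  have "sq_length I u i k \<noteq> 0" "sq_length I u i j \<noteq> 0" using pos by auto
  note var = angle_variation_weights[OF this, of "sq_length I u j k" "(exp (u $ j))\<^sup>2" "(exp (u $ k))\<^sup>2"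
      _ _ "(exp (u $ i))\<^sup>2", folded w]
  show ?thesis
    using has_derivative_clamped_angle[OF has_derivative_sq_length has_derivative_sq_length
        has_derivative_sq_length pos(3,2,1) assms(2)[unfolded nondegenerate_def]]
    unfolding face_angle_def[abs_def] face_heron_def[symmetric] var by simp
qed

lemma face_form_nonneg:
  assumes "nonneg_face I i j k" "nondegenerate I i j k u"
  defines "Q \<equiv> \<lambda>a b c. face_weight I i j k u * (b - c)\<^sup>2 + face_weight I j i k u * (a - c)\<^sup>2
      + face_weight I k i j u * (a - b)\<^sup>2"
  shows "Q a b c \<ge> 0" "Q a b c = 0 \<Longrightarrow> a = b \<and> b = c"
proof -
  have w: "face_weight I k i j u = edge_weight (sq_length I u i j) (sq_length I u j k) (sq_length I u i k)
      ((exp (u $ k))\<^sup>2) ((exp (u $ i))\<^sup>2) ((exp (u $ j))\<^sup>2)"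
    "face_weight I j i k u = edge_weight (sq_length I u i k) (sq_length I u j k) (sq_length I u i j)
      ((exp (u $ j))\<^sup>2) ((exp (u $ i))\<^sup>2) ((exp (u $ k))\<^sup>2)"
    by (simp_all add: face_weight_def sq_length_commute[of I u j i]
      sq_length_commute[of I u k i] sq_length_commute[of I u k j])
  have I: "I {j, k} \<ge> 0" "I {i, k} \<ge> 0" "I {i, j} \<ge> 0"
    using assms(1) by (auto simp: nonneg_face_def)
  note H = face_heron_pos[OF assms(1,2), unfolded face_heron_def sq_length_def]
  note * = edge_weight_form_pos[OF exp_gt_zero exp_gt_zero exp_gt_zero I H]
  show "Q a b c \<ge> 0" "Q a b c = 0 \<Longrightarrow> a = b \<and> b = c"
    unfolding Q_def w face_weight_def[of I i j k] sq_length_def using * by blast+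
qed

lemma face_angles_eq:
  assumes "i \<noteq> j" "i \<noteq> k" "j \<noteq> k" "nonneg_face I i j k"
  shows "face_angles I u {i, j, k} = face_angle I i j k u *\<^sub>R axis i 1
     + face_angle I j i k u *\<^sub>R axis j 1 + face_angle I k i j u *\<^sub>R axis k 1"
proof -
  have "at_vertex (gen_angle I (exp_vec u)) i {i, j, k} = face_angle I i j k u"
    "at_vertex (gen_angle I (exp_vec u)) j {j, i, k} = face_angle I j i k u"
    "at_vertex (gen_angle I (exp_vec u)) k {k, i, j} = face_angle I k i j u"
    using at_vertex_eq[of "gen_angle I (exp_vec u)", OF gen_angle_commute] assms(1-3)
      gen_angle_eq_face_angle[of I] assms(4) nonneg_face_rotate[OF assms(4)] by auto
  moreover have "{j, i, k} = {i, j, k}" "{k, i, j} = {i, j, k}" by auto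
  ultimately show ?thesis using assms(1-3) by (simp add: face_angles_def)
qed

text \<open>Infinitesimal rigidity of a face: pairing the derivative with \<open>w\<close> gives minus the weighted Laplacian form of
  the triangle, so only vectors constant on the face are null.\<close>

lemma face_angles_has_derivative:
  assumes "i \<noteq> j" "i \<noteq> k" "j \<noteq> k" and nn: "nonneg_face I i j k" and nd: "nondegenerate I i j k u"
  obtains D where "((\<lambda>u. face_angles I u {i, j, k}) has_derivative D) (at u)"
    and "\<And>w. D w \<bullet> w \<le> 0" and "\<And>w. D w \<bullet> w = 0 \<Longrightarrow> w $ i = w $ j \<and> w $ j = w $ k"
proof -
  let ?p = "face_weight I i j k u" and ?q = "face_weight I j i k u" and ?s = "face_weight I k i j u"
  let ?h = "sqrt (face_heron I i j k u)"
  define D where "D = (\<lambda>w::real^'a.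
      ((?s / 2 * (w $ j - w $ i) + ?q / 2 * (w $ k - w $ i)) / ?h) *\<^sub>R axis i 1
    + ((?s / 2 * (w $ i - w $ j) + ?p / 2 * (w $ k - w $ j)) / ?h) *\<^sub>R axis j 1
    + ((?q / 2 * (w $ i - w $ k) + ?p / 2 * (w $ j - w $ k)) / ?h) *\<^sub>R (axis k 1 :: real^'a))"
  have h: "?h > 0" using face_heron_pos[OF nn nd] by simp
  have cw: "face_weight I k j i u = ?s" "face_weight I j k i u = ?q" "face_weight I i k j u = ?p"
    by (simp_all only: face_weight_commute)
  have hh: "face_heron I j i k u = face_heron I i j k u" "face_heron I k i j u = face_heron I i j k u"
    by (rule face_heron_rotate)+
  note rot = nonneg_face_rotate[OF nn] nondegenerate_rotate[OF nd]
  have "((\<lambda>u. face_angles I u {i, j, k}) has_derivative D) (at u)"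
    unfolding face_angles_eq[OF assms(1-4)] D_def
    using has_derivative_face_angle[OF nn nd]
      has_derivative_face_angle[of I j i k u] has_derivative_face_angle[of I k i j u] rot
    unfolding cw hh
    by (intro has_derivative_add has_derivative_scaleR_left) auto
  moreover have form: "D w \<bullet> w = - (?p * (w $ j - w $ k)\<^sup>2 + ?q * (w $ i - w $ k)\<^sup>2 + ?s * (w $ i - w $ j)\<^sup>2) / (2 * ?h)"
    for w
    unfolding D_def inner_add_left inner_scaleR_left inner_axis' using h
    by (simp add: divide_simps) (simp add: power2_eq_square algebra_simps)
  note Q = face_form_nonneg[OF nn nd, where a = "w $ i" and b = "w $ j" and c = "w $ k" for w]
  have "D w \<bullet> w \<le> 0" for w
    unfolding form using Q(1)[of w] h by (intro divide_nonpos_pos) simp_all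
  moreover have "w $ i = w $ j \<and> w $ j = w $ k" if "D w \<bullet> w = 0" for w
    using that Q(2)[of w] h unfolding form by (simp only: divide_eq_0_iff neg_equal_0_iff_equal) simp
  ultimately show ?thesis by (rule that)
qed

lemma continuous_face_angles:
  assumes "i \<noteq> j" "i \<noteq> k" "j \<noteq> k" and nn: "nonneg_face I i j k"
  shows "continuous_on S (\<lambda>u. face_angles I u {i, j, k})"
  unfolding face_angles_eq[OF assms]
  using nn nonneg_face_rotate[OF nn] by (intro continuous_intros continuous_face_angle) auto

lemma sum_face_angles:
  assumes "i \<noteq> j" "i \<noteq> k" "j \<noteq> k" and nn: "nonneg_face I i j k"
  shows "(\<Sum>l\<in>UNIV. face_angles I u {i, j, k} $ l) = pi"
proof -
  have "(\<Sum>l\<in>UNIV. (c *\<^sub>R axis i 1 :: real^'a) $ l) = c" for c and i :: 'a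
    by (simp add: axis_def if_distrib[of "(*) c"] cong: if_cong)
  then show ?thesis
    unfolding face_angles_eq[OF assms] vector_add_component sum.distrib
    using face_angle_sum[OF nn] by metis
qed

lemma norm_face_angles_le:
  assumes "i \<noteq> j" "i \<noteq> k" "j \<noteq> k" and nn: "nonneg_face I i j k"
  shows "norm (face_angles I u {i, j, k}) \<le> 3 * pi"
proof -
  have b: "norm (face_angle I i j k u *\<^sub>R axis i 1 :: real^'a) \<le> pi" for i j k
    using face_angle_bounds[of I i j k u] by simp
  show ?thesis unfolding face_angles_eq[OF assms]
    using norm_triangle_mono[OF norm_triangle_mono[OF b b] b] by simp
qed

text \<open>Restricted to the segment from \<open>v\<close> to \<open>u\<close> and paired with \<open>u - v\<close>, the angle vector is continuous, has
  nonpositive derivative at nondegenerate parameters, and takes at most eight values at the others.\<close>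

lemma face_angles_antimonotone:
  assumes dist: "i \<noteq> j" "i \<noteq> k" "j \<noteq> k" and nn: "nonneg_face I i j k"
  shows "(face_angles I u {i, j, k} - face_angles I v {i, j, k}) \<bullet> (u - v) \<le> 0"
proof -
  define w where "w = u - v"
  let ?T = "\<lambda>u. face_angles I u {i, j, k}"
  define g where "g = (\<lambda>s::real. ?T (v + s *\<^sub>R w) \<bullet> w)"
  define Y where "Y = (\<lambda>(a, b, c). a * w $ i + b * w $ j + c * w $ k) ` ({0, pi} \<times> {0, pi} \<times> {0, pi})"
  have "g 1 \<le> g 0"
  proof (rule nonincreasing_off_finitely_many_values[where g = g and a = 0 and b = 1 and Y = Y])
    show "continuous_on {0..1} g"
      unfolding g_def
      by (intro continuous_intros continuous_on_compose2[OF continuous_face_angles[OF dist nn, of UNIV]]) auto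
    show "finite Y" by (simp add: Y_def)
    fix s :: real
    assume Y: "g s \<notin> Y"
    have nd: "nondegenerate I i j k (v + s *\<^sub>R w)"
    proof (rule ccontr)
      assume n: "\<not> nondegenerate I i j k (v + s *\<^sub>R w)"
      then have n': "\<not> nondegenerate I j i k (v + s *\<^sub>R w)" "\<not> nondegenerate I k i j (v + s *\<^sub>R w)"
        using nondegenerate_rotate[of I j i k] nondegenerate_rotate[of I k i j]
          nondegenerate_rotate[of I i k j] by blast+
      have "g s = face_angle I i j k (v + s *\<^sub>R w) * w $ i
          + face_angle I j i k (v + s *\<^sub>R w) * w $ j + face_angle I k i j (v + s *\<^sub>R w) * w $ k"
        by (simp add: g_def face_angles_eq[OF dist nn] inner_add_left inner_axis')
      then have "g s \<in> Y"
        unfolding Y_def image_iff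
        using face_angle_degenerate[OF nn n] face_angle_degenerate[OF _ n'(1)]
          face_angle_degenerate[OF _ n'(2)] nonneg_face_rotate[OF nn]
        by (intro bexI[of _ "(face_angle I i j k (v + s *\<^sub>R w), face_angle I j i k (v + s *\<^sub>R w),
              face_angle I k i j (v + s *\<^sub>R w))"]) auto
      then show False using Y by simp
    qed
    obtain D where D: "(?T has_derivative D) (at (v + s *\<^sub>R w))" "\<And>w. D w \<bullet> w \<le> 0"
      using face_angles_has_derivative[OF dist nn nd] by metis
    have "((\<lambda>s. v + s *\<^sub>R w) has_derivative (\<lambda>h. h *\<^sub>R w)) (at s)"
      by (auto intro!: derivative_eq_intros)
    from has_derivative_compose[OF this D(1)]
    have "((\<lambda>s. ?T (v + s *\<^sub>R w)) has_derivative (\<lambda>h. D (h *\<^sub>R w))) (at s)" .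
    from has_derivative_inner_left[OF this, of w]
    have "(g has_derivative (\<lambda>h. D (h *\<^sub>R w) \<bullet> w)) (at s)" by (simp add: g_def)
    moreover have "(\<lambda>h. D (h *\<^sub>R w) \<bullet> w) = (*) (D w \<bullet> w)"
      using D(1) by (auto simp: fun_eq_iff linear_scale[OF has_derivative_linear])
    ultimately have "(g has_real_derivative (D w \<bullet> w)) (at s)"
      by (simp add: has_field_derivative_def)
    then show "\<exists>d\<le>0. (g has_real_derivative d) (at s)" using D(2) by blast
  qed auto
  then show ?thesis by (simp add: g_def w_def inner_diff_left)
qed

section \<open>Flows of bounded dissipative vector fields\<close>

lemma nonincreasing_if_derivative_nonpos_within:
  fixes \<phi> :: "real \<Rightarrow> real"
  assumes "a \<le> b" "{a..b} \<subseteq> J"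
    and der: "\<And>t. t \<in> {a..b} \<Longrightarrow> \<exists>d\<le>0. (\<phi> has_real_derivative d) (at t within J)"
  shows "\<phi> b \<le> \<phi> a"
proof (rule DERIV_nonpos_imp_decreasing_open[OF \<open>a \<le> b\<close>])
  have *: "\<exists>d\<le>0. (\<phi> has_real_derivative d) (at t within {a..b})" if "t \<in> {a..b}" for t
    using der[OF that] DERIV_subset[OF _ assms(2)] by blast
  show "\<exists>y. (\<phi> has_real_derivative y) (at t) \<and> y \<le> 0" if "a < t" "t < b" for t
    using *[of t] that by (auto simp: at_within_Icc_at)
  show "continuous_on {a..b} \<phi>"
    using * by (meson DERIV_continuous continuous_on_eq_continuous_within)
qed

lemma has_real_derivative_norm_power2_diff:
  fixes u v :: "real \<Rightarrow> 'a::real_inner"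
  assumes "(u has_vector_derivative du) (at t within J)" "(v has_vector_derivative dv) (at t within J)"
  shows "((\<lambda>t. (norm (u t - v t))\<^sup>2) has_real_derivative 2 * ((u t - v t) \<bullet> (du - dv))) (at t within J)"
proof -
  note d = has_vector_derivative_diff[OF assms]
  show ?thesis
    using bounded_bilinear.has_vector_derivative[OF bounded_bilinear_inner d d]
    unfolding power2_norm_eq_inner has_real_derivative_iff_has_vector_derivative
    by (simp add: inner_commute)
qed

lemma at_within_Icc_eq_atLeast:
  fixes t :: real
  assumes "t < T"
  shows "at t within {a..T} = at t within {a..}"
  by (rule at_within_nhd[of t "{..<T}"]) (use assms in auto)

lemma integral_from_0_lipschitz:
  fixes g :: "real \<Rightarrow> 'a::euclidean_space"
  assumes "continuous_on UNIV g" "\<And>s. norm (g s) \<le> B"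
  shows "norm (integral {0..t} g - integral {0..s} g) \<le> B * \<bar>t - s\<bar>"
proof -
  have B: "B \<ge> 0" using assms(2)[of 0] norm_ge_zero order_trans by blast
  have le: "norm (integral {0..t} g - integral {0..s} g) \<le> B * (t - s)" if "0 \<le> s" "s \<le> t" for s t
  proof -
    have "integral {0..s} g + integral {s..t} g = integral {0..t} g"
      using that by (intro Henstock_Kurzweil_Integration.integral_combine integrable_continuous_real
          continuous_on_subset[OF assms(1)]) auto
    then have "integral {0..t} g - integral {0..s} g = integral {s..t} g" by (simp add: algebra_simps)
    moreover have "norm (integral {s..t} g) \<le> B * (t - s)"
      using that assms by (intro integral_bound continuous_on_subset[OF assms(1)]) auto
    ultimately show ?thesis by simp
  qed
  have max: "integral {0..t} g = integral {0..max 0 t} g" for t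
    by (cases "t \<ge> 0") (auto simp: max_def)
  have "norm (integral {0..max 0 t} g - integral {0..max 0 s} g) \<le> B * \<bar>max 0 t - max 0 s\<bar>"
    using le[of "max 0 s" "max 0 t"] le[of "max 0 t" "max 0 s"]
    by (simp add: abs_if norm_minus_commute max_def split: if_splits)
  also have "\<dots> \<le> B * \<bar>t - s\<bar>" using B by (intro mult_left_mono) auto
  finally show ?thesis by (simp only: max[symmetric])
qed

lemma integral_from_0_has_vector_derivative:
  fixes g :: "real \<Rightarrow> 'a::euclidean_space"
  assumes "continuous_on {0..} g" "t \<ge> 0"
  shows "((\<lambda>t. integral {0..t} g) has_vector_derivative g t) (at t within {0..})"
  using integral_has_vector_derivative[of 0 "t + 1" g t] assms
    at_within_Icc_eq_atLeast[of t "t + 1" 0] continuous_on_subset[OF assms(1), of "{0..t + 1}"]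
  by auto

text \<open>Picard iterates of the delay equation \<open>u'(t) = f (u (t - h))\<close> with \<open>u = x\<close> on the negative half-line, which the
  convention that integrals over empty intervals vanish provides. The \<open>n\<close>-th iterate is exact up to time
  \<open>n * h\<close>, so no fixed point argument is needed.\<close>

primrec delayed_flow :: "('a::euclidean_space \<Rightarrow> 'a) \<Rightarrow> 'a \<Rightarrow> real \<Rightarrow> nat \<Rightarrow> real \<Rightarrow> 'a" where
  "delayed_flow f x h 0 = (\<lambda>t. x)"
| "delayed_flow f x h (Suc n) = (\<lambda>t. x + integral {0..t} (\<lambda>s. f (delayed_flow f x h n (s - h))))"

locale bounded_vector_field =
  fixes f :: "'a::euclidean_space \<Rightarrow> 'a" and B :: real
  assumes cont: "continuous_on UNIV f" and bound: "\<And>x. norm (f x) \<le> B"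
begin

lemma delayed_flow_lipschitz:
  "continuous_on UNIV (delayed_flow f x h n) \<and>
   (\<forall>t s. norm (delayed_flow f x h n t - delayed_flow f x h n s) \<le> B * \<bar>t - s\<bar>)"
proof (induction n)
  case 0
  have "B \<ge> 0" using bound norm_ge_zero order_trans by blast
  then show ?case by simp
next
  case (Suc n)
  have "continuous_on UNIV (\<lambda>s. f (delayed_flow f x h n (s - h)))"
  proof (rule continuous_on_compose2[OF cont])
    show "continuous_on UNIV (\<lambda>s. delayed_flow f x h n (s - h))"
      by (rule continuous_on_compose2[OF conjunct1[OF Suc]]) (auto intro!: continuous_intros)
  qed simp
  then have L: "norm (delayed_flow f x h (Suc n) t - delayed_flow f x h (Suc n) s) \<le> B * \<bar>t - s\<bar>" for t s
    using integral_from_0_lipschitz[OF _ bound, of "\<lambda>s. delayed_flow f x h n (s - h)"] by simp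
  have "(B)-lipschitz_on UNIV (delayed_flow f x h (Suc n))"
  proof (rule lipschitz_onI)
    show "B \<ge> 0" using bound norm_ge_zero order_trans by blast
  qed (use L in \<open>simp add: dist_norm\<close>)
  then show ?case using L lipschitz_on_continuous_on by blast
qed

lemma continuous_delayed_field: "continuous_on S (\<lambda>s. f (delayed_flow f x h n (s - h)))"
proof (rule continuous_on_compose2[OF cont])
  show "continuous_on S (\<lambda>s. delayed_flow f x h n (s - h))"
    by (rule continuous_on_compose2[OF conjunct1[OF delayed_flow_lipschitz]]) (auto intro!: continuous_intros)
qed simp

lemma delayed_flow_stabilises:
  assumes "h > 0" "t \<le> n * h"
  shows "delayed_flow f x h (Suc n) t = delayed_flow f x h n t"
  using assms(2)
proof (induction n arbitrary: t)
  case 0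
  then show ?case by (cases "t = 0") auto
next
  case (Suc n)
  have "integral {0..t} (\<lambda>s. f (delayed_flow f x h (Suc n) (s - h)))
      = integral {0..t} (\<lambda>s. f (delayed_flow f x h n (s - h)))"
  proof (rule integral_cong)
    fix s assume "s \<in> {0..t}"
    then have "s - h \<le> real n * h" using Suc.prems by (auto simp: algebra_simps)
    from Suc.IH[OF this]
    show "f (delayed_flow f x h (Suc n) (s - h)) = f (delayed_flow f x h n (s - h))" by simp
  qed
  then show ?case by simp
qed

end

locale dissipative_vector_field = bounded_vector_field +
  assumes dissipative: "\<And>x y. (f x - f y) \<bullet> (x - y) \<le> 0"
begin

text \<open>With delay \<open>h m = 1 / (m + 1)\<close> and \<open>(m + 1)\<^sup>2 + 1\<close> iterations, \<open>U m\<close> solves the delay equation up to time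
  \<open>m + 1\<close>. The field is evaluated at arguments at distance at most \<open>B * h\<close> from the current ones, so
  dissipativity bounds the derivative of \<open>|U m - U k|\<^sup>2\<close> by \<open>4 * B\<^sup>2 * (h m + h k)\<close>. Pointwise convergence follows, and
  dominated convergence passes to the limit in the integral equation.\<close>

lemma global_solution_exists:
  "\<exists>u. u 0 = x \<and> (\<forall>t\<in>{0..}. (u has_vector_derivative f (u t)) (at t within {0..}))"
proof -
  define h where "h m = 1 / real (Suc m)" for m
  define N where "N m = Suc m * Suc m" for m
  define W where "W m = delayed_flow f x (h m) (N m)" for m
  define U where "U m = delayed_flow f x (h m) (Suc (N m))" for m
  define u where "u t = lim (\<lambda>m. U m t)" for t
  have h: "h m > 0" "real (N m) * h m = real (Suc m)" for m
    unfolding h_def N_def of_nat_mult by simp_all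
  have B: "B \<ge> 0" using bound norm_ge_zero order_trans by blast
  have lip: "norm (U m t - U m s) \<le> B * \<bar>t - s\<bar>" for m t s
    using delayed_flow_lipschitz unfolding U_def by blast
  have UW: "W m t = U m t" if "t \<le> real (Suc m)" for m t
    using delayed_flow_stabilises[OF h(1), of t "N m" m x] that unfolding h(2) U_def W_def by simp
  have Ufun: "U m = (\<lambda>t. x + integral {0..t} (\<lambda>s. f (W m (s - h m))))" for m
    by (simp add: U_def W_def)
  have contW: "continuous_on S (\<lambda>s. f (W m (s - h m)))" for S m
    unfolding W_def by (rule continuous_delayed_field)
  have der: "(U m has_vector_derivative f (U m (t - h m))) (at t within {0..})"
    if "0 \<le> t" "t \<le> real (Suc m)" for m t
  proof -
    have "(U m has_vector_derivative 0 + f (W m (t - h m))) (at t within {0..})"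
      unfolding Ufun using that by (intro has_vector_derivative_add has_vector_derivative_const
          integral_from_0_has_vector_derivative contW)
    moreover have "W m (t - h m) = U m (t - h m)"
      using that h(1)[of m] by (intro UW) linarith
    ultimately show ?thesis by simp
  qed
  have close: "(norm (U m T - U k T))\<^sup>2 \<le> 4 * B\<^sup>2 * (h m + h k) * T"
    if T: "0 \<le> T" "T \<le> real (Suc m)" "T \<le> real (Suc k)" for m k T
  proof -
    let ?M = "4 * B\<^sup>2 * (h m + h k)"
    have "(norm (U m T - U k T))\<^sup>2 - ?M * T \<le> (norm (U m 0 - U k 0))\<^sup>2 - ?M * 0"
    proof (rule nonincreasing_if_derivative_nonpos_within[where J = "{0..}" and a = 0 and b = T
          and \<phi> = "\<lambda>t. (norm (U m t - U k t))\<^sup>2 - ?M * t"])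
      fix t assume "t \<in> {0..T}"
      then have t: "0 \<le> t" "t \<le> real (Suc m)" "t \<le> real (Suc k)" using T by auto
      define a b where "a = U m (t - h m)" and "b = U k (t - h k)"
      define e where "e = (U m t - a) - (U k t - b)"
      have d: "((\<lambda>t. (norm (U m t - U k t))\<^sup>2 - ?M * t) has_real_derivative
          2 * ((U m t - U k t) \<bullet> (f a - f b)) - ?M) (at t within {0..})"
        unfolding a_def b_def
        by (rule derivative_eq_intros has_real_derivative_norm_power2_diff der t refl)+ simp
      have "norm e \<le> norm (U m t - a) + norm (U k t - b)" unfolding e_def by (rule norm_triangle_ineq4)
      also have "\<dots> \<le> B * (h m + h k)"
        using lip[of m t "t - h m"] lip[of k t "t - h k"] h(1)[of m] h(1)[of k]
        by (simp add: a_def b_def algebra_simps)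
      finally have e: "norm e \<le> B * (h m + h k)" .
      have "norm (f a - f b) \<le> 2 * B"
        using norm_triangle_ineq4[of "f a" "f b"] bound[of a] bound[of b] by linarith
      then have "norm e * norm (f a - f b) \<le> B * (h m + h k) * (2 * B)"
        using e B h(1)[of m] h(1)[of k] by (intro mult_mono) auto
      then have "e \<bullet> (f a - f b) \<le> B * (h m + h k) * (2 * B)"
        using norm_cauchy_schwarz[of e "f a - f b"] by linarith
      moreover have "(U m t - U k t) \<bullet> (f a - f b) = (f a - f b) \<bullet> (a - b) + e \<bullet> (f a - f b)"
        by (simp add: e_def inner_commute inner_diff_left inner_diff_right)
      moreover have "B * (h m + h k) * (2 * B) = ?M / 2" by (simp add: power2_eq_square)
      ultimately have "2 * ((U m t - U k t) \<bullet> (f a - f b)) - ?M \<le> 0"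
        using dissipative[of a b] by linarith
      then show "\<exists>d\<le>0. ((\<lambda>t. (norm (U m t - U k t))\<^sup>2 - ?M * t) has_real_derivative d) (at t within {0..})"
        using d by blast
    qed (use T in auto)
    then show ?thesis by (simp add: U_def)
  qed
  have "Cauchy (\<lambda>m. U m t)" if t: "t \<ge> 0" for t
  proof (rule metric_CauchyI)
    fix \<epsilon> :: real assume \<epsilon>: "\<epsilon> > 0"
    obtain M where M: "real M > max t (8 * B\<^sup>2 * t / \<epsilon>\<^sup>2)" using reals_Archimedean2 by blast
    have "dist (U m t) (U k t) < \<epsilon>" if "m \<ge> M" "k \<ge> M" for m k
    proof -
      have M1: "real M > t" "8 * B\<^sup>2 * t / \<epsilon>\<^sup>2 < real M" using M by simp_all
      have hm: "h m + h k \<le> 2 / real (Suc M)"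
        using that frac_le[of 1 1 "real (Suc M)" "real (Suc m)"] frac_le[of 1 1 "real (Suc M)" "real (Suc k)"]
        by (simp add: h_def)
      have "(norm (U m t - U k t))\<^sup>2 \<le> 4 * B\<^sup>2 * (h m + h k) * t"
        using that t M1 by (intro close) auto
      also have "\<dots> \<le> 4 * B\<^sup>2 * (2 / real (Suc M)) * t"
        using hm t by (intro mult_right_mono mult_left_mono) auto
      also have "\<dots> = 8 * B\<^sup>2 * t / real (Suc M)" by simp
      also have "\<dots> < \<epsilon>\<^sup>2"
      proof -
        have "8 * B\<^sup>2 * t < real M * \<epsilon>\<^sup>2" using M1(2) \<epsilon> by (simp add: pos_divide_less_eq)
        also have "\<dots> \<le> real (Suc M) * \<epsilon>\<^sup>2" by (intro mult_right_mono) auto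
        finally show ?thesis by (simp add: pos_divide_less_eq mult.commute)
      qed
      finally show ?thesis
        unfolding dist_norm by (rule power2_less_imp_less) (use \<epsilon> in simp)
    qed
    then show "\<exists>M. \<forall>m\<ge>M. \<forall>n\<ge>M. dist (U m t) (U n t) < \<epsilon>" by blast
  qed
  then have u: "(\<lambda>m. U m t) \<longlonglongrightarrow> u t" if "t \<ge> 0" for t
    using that unfolding u_def by (simp add: Cauchy_convergent_iff convergent_LIMSEQ_iff)
  have h0: "h \<longlonglongrightarrow> 0"
    unfolding h_def using LIMSEQ_inverse_real_of_nat by (simp add: inverse_eq_divide)
  have lim: "(\<lambda>m. f (W m (s - h m))) \<longlonglongrightarrow> f (u s)" if "s \<ge> 0" for s
  proof -
    have "(\<lambda>m. U m (s - h m) - U m s) \<longlonglongrightarrow> 0"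
    proof (rule Lim_null_comparison)
      show "\<forall>\<^sub>F m in sequentially. norm (U m (s - h m) - U m s) \<le> B * h m"
      proof (intro always_eventually allI)
        show "norm (U m (s - h m) - U m s) \<le> B * h m" for m
          using lip[of m "s - h m" s] h(1)[of m] by simp
      qed
      show "(\<lambda>m. B * h m) \<longlonglongrightarrow> 0" using tendsto_mult_right_zero[OF h0] by simp
    qed
    from tendsto_add[OF this u[OF that]] have "(\<lambda>m. U m (s - h m)) \<longlonglongrightarrow> u s" by simp
    moreover have "\<forall>\<^sub>F m in sequentially. U m (s - h m) = W m (s - h m)"
    proof (rule eventually_sequentiallyI)
      fix m assume "nat \<lceil>s\<rceil> \<le> m"
      then have "s - h m \<le> real (Suc m)" using h(1)[of m] by linarith
      then show "U m (s - h m) = W m (s - h m)" by (simp add: UW)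
    qed
    ultimately have "(\<lambda>m. W m (s - h m)) \<longlonglongrightarrow> u s" by (rule Lim_transform_eventually)
    then show ?thesis
      using continuous_on_tendsto_compose[OF cont] by simp
  qed
  have dom: "(\<lambda>s. f (W m (s - h m))) integrable_on {0..t}" "(\<lambda>s. B) integrable_on {0..t}"
    "\<And>s. s \<in> {0..t} \<Longrightarrow> norm (f (W m (s - h m))) \<le> B"
    "\<And>s. s \<in> {0..t} \<Longrightarrow> (\<lambda>m. f (W m (s - h m))) \<longlonglongrightarrow> f (u s)" for m t
    using bound lim contW by (auto intro!: integrable_continuous_real)
  note int = dominated_convergence[OF dom]
  have ueq: "u t = x + integral {0..t} (\<lambda>s. f (u s))" if "t \<ge> 0" for t
  proof (rule LIMSEQ_unique[OF u[OF that]])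
    show "(\<lambda>m. U m t) \<longlonglongrightarrow> x + integral {0..t} (\<lambda>s. f (u s))"
      unfolding Ufun by (intro tendsto_add tendsto_const int)
  qed
  have "continuous_on {0..T} u" for T
  proof -
    have "continuous_on {0..T} (\<lambda>t. x + integral {0..t} (\<lambda>s. f (u s)))"
      by (intro continuous_on_add continuous_on_const indefinite_integral_continuous_1 int)
    then show ?thesis by (rule continuous_on_eq) (simp add: ueq)
  qed
  then have "continuous (at t within {0..t + 1}) u" if "t \<ge> 0" for t
    using that by (auto simp: continuous_on_eq_continuous_within)
  then have cu: "continuous (at t within {0..}) u" if "t \<ge> 0" for t
    unfolding at_within_Icc_eq_atLeast[of t "t + 1" 0, OF less_add_one, symmetric] using that by blast
  then have "continuous_on {0..} u" by (simp add: continuous_on_eq_continuous_within)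
  from continuous_on_compose2[OF cont this] have "continuous_on {0..} (\<lambda>s. f (u s))" by simp
  then have d: "((\<lambda>t. x + integral {0..t} (\<lambda>s. f (u s))) has_vector_derivative 0 + f (u t)) (at t within {0..})"
    if "t \<ge> 0" for t
    using that by (intro has_vector_derivative_add has_vector_derivative_const
          integral_from_0_has_vector_derivative)
  have "(u has_vector_derivative f (u t)) (at t within {0..})" if "t \<in> {0..}" for t
  proof (rule has_vector_derivative_transform_within[OF _ zero_less_one that])
    show "((\<lambda>t. x + integral {0..t} (\<lambda>s. f (u s))) has_vector_derivative f (u t)) (at t within {0..})"
      using d[of t] that by simp
    show "x + integral {0..t'} (\<lambda>s. f (u s)) = u t'" if "t' \<in> {0..}" for t'
      using ueq[of t'] that by simp
  qed
  moreover have "u 0 = x" using ueq[of 0] by simp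
  ultimately show ?thesis by blast
qed

lemma solution_unique:
  assumes u: "\<And>t. t \<in> {0..<T} \<Longrightarrow> (u has_vector_derivative f (u t)) (at t within {0..<T})"
    and v: "\<And>t. t \<in> {0..<T} \<Longrightarrow> (v has_vector_derivative f (v t)) (at t within {0..<T})"
    and "u 0 = v 0" "t \<in> {0..<T}"
  shows "u t = v t"
proof -
  have "(norm (u t - v t))\<^sup>2 \<le> (norm (u 0 - v 0))\<^sup>2"
  proof (rule nonincreasing_if_derivative_nonpos_within[where J = "{0..<T}" and a = 0 and b = t
        and \<phi> = "\<lambda>t. (norm (u t - v t))\<^sup>2"])
    fix s assume "s \<in> {0..t}"
    then have s: "s \<in> {0..<T}" using assms(4) by auto
    show "\<exists>d\<le>0. ((\<lambda>t. (norm (u t - v t))\<^sup>2) has_real_derivative d) (at s within {0..<T})"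
      using has_real_derivative_norm_power2_diff[OF u[OF s] v[OF s]] dissipative[of "u s" "v s"]
      by (intro exI conjI) (auto simp: inner_commute)
  qed (use assms(4) in auto)
  then show ?thesis using assms(3) by simp
qed

text \<open>The local bound spreads to the ball of radius \<open>R\<close> because \<open>f (a + s *\<^sub>R e) \<bullet> e\<close> is nonincreasing in \<open>s\<close>: beyond
  radius \<open>\<delta>\<close> it stays below \<open>- c * \<delta>\<close>, which is at most \<open>- k * |w|\<close> for \<open>|w| \<le> R\<close>. The solution never leaves
  that ball.\<close>

lemma exponential_decay_to_stable_zero:
  assumes u: "\<And>t. t \<in> {0..} \<Longrightarrow> (u has_vector_derivative f (u t)) (at t within {0..})"
    and S: "subspace S" "\<And>t. t \<ge> 0 \<Longrightarrow> u t - a \<in> S"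
    and zero: "f a = 0"
    and stable: "c > 0" "\<delta> > 0" "\<And>w. w \<in> S \<Longrightarrow> norm w \<le> \<delta> \<Longrightarrow> f (a + w) \<bullet> w \<le> - c * (norm w)\<^sup>2"
  shows "\<exists>C>0. \<exists>k>0. \<forall>t\<ge>0. norm (u t - a) \<le> C * exp (- k * t)"
proof -
  define R where "R = norm (u 0 - a)"
  \<comment> \<open>At most both \<open>c\<close> and \<open>c * \<delta> / R\<close>; the sum in the denominator covers \<open>R = 0\<close>.\<close>
  define k where "k = c * \<delta> / (\<delta> + R)"
  have R: "R \<ge> 0" by (simp add: R_def)
  have k: "k > 0" using stable R by (simp add: k_def)
  have dist: "((\<lambda>t. (norm (u t - a))\<^sup>2) has_real_derivative 2 * ((u t - a) \<bullet> f (u t))) (at t within {0..})"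
    if "t \<in> {0..}" for t
    using has_real_derivative_norm_power2_diff[OF u[OF that] has_vector_derivative_const[of a]] by simp
  have within: "norm (u t - a) \<le> R" if "t \<ge> 0" for t
  proof -
    have "(norm (u t - a))\<^sup>2 \<le> (norm (u 0 - a))\<^sup>2"
    proof (rule nonincreasing_if_derivative_nonpos_within[where J = "{0..}" and a = 0 and b = t
          and \<phi> = "\<lambda>t. (norm (u t - a))\<^sup>2"])
      fix s assume "s \<in> {0..t}"
      then show "\<exists>d\<le>0. ((\<lambda>t. (norm (u t - a))\<^sup>2) has_real_derivative d) (at s within {0..})"
        using dist[of s] dissipative[of "u s" a] zero by (intro exI conjI) (auto simp: inner_commute)
    qed (use that in auto)
    then show ?thesis by (simp add: R_def)
  qed
  have coercive: "f (a + w) \<bullet> w \<le> - k * (norm w)\<^sup>2" if "w \<in> S" "norm w \<le> R" for w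
  proof (cases "norm w \<le> \<delta>")
    case True
    have "k \<le> c" using stable R by (simp add: k_def divide_simps)
    then have "k * (norm w)\<^sup>2 \<le> c * (norm w)\<^sup>2" by (intro mult_right_mono) auto
    then show ?thesis using stable(3)[OF that(1) True] by linarith
  next
    case False
    define \<mu> where "\<mu> = \<delta> / norm w"
    define w' where "w' = \<mu> *\<^sub>R w"
    have npos: "norm w > 0" using False stable(2) by linarith
    then have \<mu>: "0 < \<mu>" "\<mu> < 1" using False stable(2) by (simp_all only: \<mu>_def divide_pos_pos divide_less_eq_1_pos not_le)
    have "norm w' = \<delta>" using False stable(2) by (auto simp: w'_def \<mu>_def)
    then have "f (a + w') \<bullet> w' \<le> - c * \<delta>\<^sup>2"
      using stable(3)[of w'] subspace_scale[OF S(1) that(1)] by (simp add: w'_def)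
    then have 1: "\<mu> * (f (a + w') \<bullet> w) \<le> - c * \<delta>\<^sup>2" by (simp add: w'_def)
    have "(f (a + w) - f (a + w')) \<bullet> ((a + w) - (a + w')) \<le> 0" by (rule dissipative)
    moreover have "(a + w) - (a + w') = (1 - \<mu>) *\<^sub>R w" by (simp add: w'_def algebra_simps)
    ultimately have "(1 - \<mu>) * ((f (a + w) - f (a + w')) \<bullet> w) \<le> 0" by simp
    then have "(f (a + w) - f (a + w')) \<bullet> w \<le> 0" using \<mu> by (simp add: mult_le_0_iff)
    then have "f (a + w) \<bullet> w \<le> f (a + w') \<bullet> w" by (simp add: inner_diff_left)
    then have "\<mu> * (f (a + w) \<bullet> w) \<le> \<mu> * (f (a + w') \<bullet> w)" using \<mu> by (intro mult_left_mono) auto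
    then have "\<mu> * (f (a + w) \<bullet> w) \<le> - c * \<delta>\<^sup>2" using 1 by linarith
    then have "\<delta> * (f (a + w) \<bullet> w) \<le> \<delta> * (- c * \<delta> * norm w)"
    proof -
      have n: "norm w * \<mu> = \<delta>" using npos by (simp add: \<mu>_def)
      have "norm w * (\<mu> * (f (a + w) \<bullet> w)) \<le> norm w * (- c * \<delta>\<^sup>2)"
        using \<open>\<mu> * (f (a + w) \<bullet> w) \<le> - c * \<delta>\<^sup>2\<close> by (rule mult_left_mono) simp
      then show ?thesis unfolding mult.assoc[symmetric] n by (simp add: power2_eq_square ac_simps)
    qed
    then have "f (a + w) \<bullet> w \<le> - c * \<delta> * norm w"
      using stable(2) by (simp only: mult_le_cancel_left_pos)
    moreover have "k * (norm w)\<^sup>2 \<le> c * \<delta> * norm w"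
    proof -
      have "k * norm w \<le> k * (\<delta> + R)" using that k stable(2) by (intro mult_left_mono) auto
      also have "\<dots> = c * \<delta>" using stable(2) R by (simp add: k_def)
      finally have "k * norm w * norm w \<le> c * \<delta> * norm w" by (intro mult_right_mono) auto
      then show ?thesis by (simp add: power2_eq_square mult.assoc)
    qed
    ultimately show ?thesis by linarith
  qed
  have "norm (u t - a) \<le> (R + 1) * exp (- k * t)" if t: "t \<ge> 0" for t
  proof -
    let ?\<phi> = "\<lambda>t. (norm (u t - a))\<^sup>2 * exp (2 * k * t)"
    have "?\<phi> t \<le> ?\<phi> 0"
    proof (rule nonincreasing_if_derivative_nonpos_within[where J = "{0..}" and a = 0 and b = t and \<phi> = ?\<phi>])
      fix s assume "s \<in> {0..t}"
      then have s: "s \<in> {0..}" by auto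
      let ?d = "2 * ((u s - a) \<bullet> f (u s)) * exp (2 * k * s) + (norm (u s - a))\<^sup>2 * (exp (2 * k * s) * (2 * k))"
      have "(?\<phi> has_real_derivative ?d) (at s within {0..})"
        by (rule derivative_eq_intros dist[OF s] refl)+ simp
      moreover have "?d = 2 * exp (2 * k * s) * (f (a + (u s - a)) \<bullet> (u s - a) + k * (norm (u s - a))\<^sup>2)"
        by (simp add: inner_commute algebra_simps)
      moreover have "\<dots> \<le> 0"
        using coercive[of "u s - a"] S(2)[of s] within[of s] s by (intro mult_nonneg_nonpos) auto
      ultimately show "\<exists>d\<le>0. (?\<phi> has_real_derivative d) (at s within {0..})"
        by (intro exI[of _ ?d] conjI) simp_all
    qed (use t in auto)
    then have "(norm (u t - a))\<^sup>2 * (exp (k * t))\<^sup>2 \<le> R\<^sup>2"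
      by (simp add: R_def exp_double[symmetric] mult.assoc)
    then have "(norm (u t - a) * exp (k * t))\<^sup>2 \<le> R\<^sup>2" by (simp add: power_mult_distrib)
    then have "norm (u t - a) * exp (k * t) \<le> R" using R by (rule power2_le_imp_le)
    then have "norm (u t - a) * exp (k * t) * exp (- k * t) \<le> (R + 1) * exp (- k * t)"
      by (intro mult_right_mono) auto
    then show ?thesis by (simp add: mult.assoc exp_add[symmetric])
  qed
  then show ?thesis using R k by (intro exI[of _ "R + 1"] exI[of _ k] conjI) auto
qed

end

text \<open>By compactness of the unit sphere of \<open>S\<close> the form of the derivative is bounded above by \<open>- c * |w|\<^sup>2\<close> on \<open>S\<close>; half of
  it absorbs the remainder.\<close>

lemma derivative_definite_imp_locally_stable:
  fixes f :: "'a::euclidean_space \<Rightarrow> 'a"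
  assumes D: "(f has_derivative D) (at a)" and zero: "f a = 0" and S: "subspace S"
    and neg: "\<And>w. D w \<bullet> w \<le> 0" and def: "\<And>w. w \<in> S \<Longrightarrow> D w \<bullet> w = 0 \<Longrightarrow> w = 0"
  shows "\<exists>c>0. \<exists>\<delta>>0. \<forall>w\<in>S. norm w \<le> \<delta> \<longrightarrow> f (a + w) \<bullet> w \<le> - c * (norm w)\<^sup>2"
proof -
  have lin: "bounded_linear D" using D by (rule has_derivative_bounded_linear)
  let ?K = "sphere 0 1 \<inter> S"
  have "\<exists>c>0. \<forall>w\<in>?K. D w \<bullet> w \<le> - c"
  proof (cases "?K = {}")
    case True
    then show ?thesis by (intro exI[of _ 1]) auto
  next
    case False
    have "compact ?K" using S by (intro compact_Int_closed closed_subspace) auto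
    moreover have "continuous_on ?K (\<lambda>w. D w \<bullet> w)"
      by (intro continuous_intros linear_continuous_on lin)
    ultimately obtain m where m: "m \<in> ?K" "\<And>w. w \<in> ?K \<Longrightarrow> D w \<bullet> w \<le> D m \<bullet> m"
      using continuous_attains_sup[of ?K "\<lambda>w. D w \<bullet> w"] False by blast
    have "D m \<bullet> m \<noteq> 0" using def[of m] m(1) by auto
    then have "- (D m \<bullet> m) > 0" using neg[of m] by simp
    then show ?thesis using m(2) by (intro exI[of _ "- (D m \<bullet> m)"]) auto
  qed
  then obtain c where c: "c > 0" "\<And>w. w \<in> ?K \<Longrightarrow> D w \<bullet> w \<le> - c" by blast
  have quad: "D w \<bullet> w \<le> - c * (norm w)\<^sup>2" if "w \<in> S" for w
  proof (cases "w = 0")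
    case False
    define e where "e = (1 / norm w) *\<^sub>R w"
    have "D e \<bullet> e \<le> - c" using False that S by (intro c(2)) (auto simp: e_def subspace_scale)
    moreover have "w = norm w *\<^sub>R e" using False by (simp add: e_def)
    then have "D w \<bullet> w = (norm w)\<^sup>2 * (D e \<bullet> e)"
      by (metis (no_types, lifting) bounded_linear.linear inner_scaleR_left inner_scaleR_right lin linear_scale mult.assoc power2_eq_square)
    ultimately show ?thesis
      using mult_left_mono[of "D e \<bullet> e" "- c" "(norm w)\<^sup>2"] by (simp add: mult.commute)
  qed (use linear_0[OF bounded_linear.linear[OF lin]] in simp)
  obtain \<delta> where \<delta>: "\<delta> > 0"
    "\<And>y. norm (y - a) < \<delta> \<Longrightarrow> norm (f y - f a - D (y - a)) \<le> c / 2 * norm (y - a)"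
    using D[unfolded has_derivative_at_alt] c(1) by (metis half_gt_zero)
  have "f (a + w) \<bullet> w \<le> - (c / 2) * (norm w)\<^sup>2" if "w \<in> S" "norm w \<le> \<delta> / 2" for w
  proof -
    have "norm (f (a + w) - D w) \<le> c / 2 * norm w"
      using \<delta>(2)[of "a + w"] \<delta>(1) that zero by simp
    then have "norm (f (a + w) - D w) * norm w \<le> c / 2 * norm w * norm w"
      by (intro mult_right_mono) auto
    moreover have "(f (a + w) - D w) \<bullet> w \<le> norm (f (a + w) - D w) * norm w"
      by (rule norm_cauchy_schwarz)
    ultimately have "(f (a + w) - D w) \<bullet> w \<le> c / 2 * (norm w)\<^sup>2" by (simp add: power2_eq_square mult.assoc)
    then show ?thesis using quad[OF that(1)] by (simp add: inner_diff_left)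
  qed
  then show ?thesis using c(1) \<delta>(1) by (intro exI[of _ "c / 2"] exI[of _ "\<delta> / 2"] conjI) auto
qed

text \<open>Otherwise, with \<open>v = f a\<close>, the function \<open>u \<bullet> v\<close> would eventually grow by at least \<open>|v|\<^sup>2 / 2\<close> per unit time
  although it converges.\<close>

lemma flow_limit_is_zero:
  fixes f :: "'a::euclidean_space \<Rightarrow> 'a"
  assumes cont: "continuous_on UNIV f"
    and u: "\<And>t. t \<in> {0..} \<Longrightarrow> (u has_vector_derivative f (u t)) (at t within {0..})"
    and lim: "(u \<longlongrightarrow> a) at_top"
  shows "f a = 0"
proof (rule ccontr)
  assume "f a \<noteq> 0"
  define v where "v = f a"
  have v: "v \<bullet> v > 0" using \<open>f a \<noteq> 0\<close> by (simp add: v_def)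
  have fu: "((\<lambda>t. f (u t) \<bullet> v) \<longlongrightarrow> v \<bullet> v) at_top"
    using continuous_on_tendsto_compose[OF cont lim] unfolding v_def by (intro tendsto_intros) auto
  have uv: "((\<lambda>t. u t \<bullet> v) \<longlongrightarrow> a \<bullet> v) at_top" using lim by (intro tendsto_intros)
  have "((\<lambda>t. u (t + 1) \<bullet> v) \<longlongrightarrow> a \<bullet> v) at_top"
    by (rule filterlim_compose[OF uv]) (rule filterlim_at_top_mono[OF filterlim_ident], simp)
  then have "((\<lambda>t. u (t + 1) \<bullet> v - u t \<bullet> v) \<longlongrightarrow> 0) at_top"
    using tendsto_diff[OF _ uv] by fastforce
  then have 1: "\<forall>\<^sub>F t in at_top. u (t + 1) \<bullet> v - u t \<bullet> v < v \<bullet> v / 2"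
    using v by (intro order_tendstoD(2)[of _ 0]) auto
  have 2: "\<forall>\<^sub>F t in at_top. f (u t) \<bullet> v > v \<bullet> v / 2"
    using v by (intro order_tendstoD(1)[OF fu]) auto
  obtain T1 where T1: "\<And>t. t \<ge> T1 \<Longrightarrow> u (t + 1) \<bullet> v - u t \<bullet> v < v \<bullet> v / 2"
    using 1 unfolding eventually_at_top_linorder by blast
  obtain T2 where T2: "\<And>t. t \<ge> T2 \<Longrightarrow> f (u t) \<bullet> v > v \<bullet> v / 2"
    using 2 unfolding eventually_at_top_linorder by blast
  define T where "T = max 0 (max T1 T2)"
  let ?\<phi> = "\<lambda>t. v \<bullet> v / 2 * t - u t \<bullet> v"
  have "?\<phi> (T + 1) \<le> ?\<phi> T"
  proof (rule nonincreasing_if_derivative_nonpos_within[where J = "{0..}" and a = T and b = "T + 1" and \<phi> = ?\<phi>])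
    fix t assume t: "t \<in> {T..T + 1}"
    then have "((\<lambda>t. u t \<bullet> v) has_real_derivative f (u t) \<bullet> v) (at t within {0..})"
      using bounded_linear.has_vector_derivative[OF bounded_linear_inner_left u[of t]]
      by (auto simp: T_def has_real_derivative_iff_has_vector_derivative)
    then have "(?\<phi> has_real_derivative (v \<bullet> v / 2 - f (u t) \<bullet> v)) (at t within {0..})"
      by (auto intro!: derivative_eq_intros)
    then show "\<exists>d\<le>0. (?\<phi> has_real_derivative d) (at t within {0..})"
      using T2[of t] t by (intro exI conjI) (auto simp: T_def)
  qed (auto simp: T_def)
  moreover have "v \<bullet> v / 2 * (T + 1) = v \<bullet> v / 2 * T + v \<bullet> v / 2" by (simp add: algebra_simps)
  moreover have "u (T + 1) \<bullet> v - u T \<bullet> v < v \<bullet> v / 2" by (rule T1) (simp add: T_def)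
  ultimately show False by linarith
qed

section \<open>The extended prescribed curvature flow\<close>

lemma triangulated_faceE:
  assumes "triangulates E F M" "\<forall>e\<in>E. I e \<ge> 0" "f \<in> F"
  obtains i j k where "f = {i, j, k}" "i \<noteq> j" "i \<noteq> k" "j \<noteq> k" "nonneg_face I i j k"
proof -
  have "card f = 3" using assms unfolding triangulates_def by blast
  then obtain i j k where f: "f = {i, j, k}" "i \<noteq> j" "j \<noteq> k" "i \<noteq> k"
    using card_3_iff[of f] by auto
  have "e \<in> E" if "e \<subseteq> f" "card e = 2" for e
    using assms that unfolding triangulates_def by blast
  then have edges: "I e \<ge> 0" if "e \<subseteq> f" "card e = 2" for e
    using assms(2) that by blast
  have "nonneg_face I i j k"
    unfolding nonneg_face_def using f by (intro conjI edges) auto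
  with f show ?thesis by (intro that)
qed

text \<open>The linear functional \<open>x \<mapsto> w \<bullet> x\<close> is constant on each simplex of the realization, with a component of \<open>w\<close> as
  its value. Its image of the connected realization is connected and finite, hence a point.\<close>

lemma locally_constant_vector_is_constant:
  fixes w :: "real^'v::finite"
  assumes "triangulates E F M" "connected_space M"
    and const: "\<And>f i j. f \<in> F \<Longrightarrow> i \<in> f \<Longrightarrow> j \<in> f \<Longrightarrow> w $ i = w $ j"
  shows "w $ i = w $ j"
proof -
  let ?R = "realization E F"
  have conn: "connected ?R"
    using assms(1,2) homeomorphic_connected_space[of "top_of_set ?R" M]
    unfolding triangulates_def by (simp add: connectedin_def flip: connectedin_iff_connected)
  have vertex: "axis i 1 \<in> ?R" for i
    unfolding realization_def simplices_def by (auto intro!: bexI[of _ "{i}"])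
  have "w \<bullet> x \<in> range (($) w)" if "x \<in> ?R" for x
  proof -
    obtain s where s: "s \<in> simplices E F" "x \<in> convex hull ((\<lambda>i. axis i 1) ` s)"
      using \<open>x \<in> ?R\<close> unfolding realization_def by blast
    have eq: "w $ a = w $ b" if "a \<in> s" "b \<in> s" for a b
    proof -
      have "s \<in> range (\<lambda>i. {i}) \<or> (\<exists>f\<in>F. s \<subseteq> f)"
        using s(1) assms(1) unfolding simplices_def triangulates_def by blast
      then show ?thesis using that const by blast
    qed
    obtain a where a: "a \<in> s" using s(2) by fastforce
    have "convex hull ((\<lambda>i. axis i 1) ` s) \<subseteq> {x. w \<bullet> x = w $ a}"
      by (rule hull_minimal) (auto simp: inner_axis convex_hyperplane eq[OF _ a])
    then show ?thesis using s(2) by blast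
  qed
  then have "(\<lambda>x. w \<bullet> x) ` ?R \<subseteq> range (($) w)" by blast
  then have "finite ((\<lambda>x. w \<bullet> x) ` ?R)" by (rule finite_subset) simp
  moreover have "connected ((\<lambda>x. w \<bullet> x) ` ?R)"
    by (intro connected_continuous_image conn continuous_intros)
  ultimately obtain c where c: "(\<lambda>x. w \<bullet> x) ` ?R = {c}"
    using connected_finite_iff_sing vertex[of i] by blast
  have "w $ i = c" for i
  proof -
    have "w \<bullet> axis i 1 \<in> {c}" unfolding c[symmetric] using vertex by (rule imageI)
    then show ?thesis by (simp add: inner_axis)
  qed
  then show ?thesis by simp
qed

lemma ext_curvature_eq_face_angles:
  "ext_curvature F I (exp_vec u) = (\<chi> i. 2 * pi) - (\<Sum>f\<in>F. face_angles I u f)"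
proof -
  have "face_angles I u f $ i = (if i \<in> f then at_vertex (gen_angle I (exp_vec u)) i f else 0)" for f i
    unfolding face_angles_def sum_component vector_scaleR_component axis_def
    by (simp add: if_distrib[of "(*) _"] cong: if_cong)
  then show ?thesis
    by (simp add: ext_curvature_def vec_eq_iff sum.inter_filter)
qed

lemma ext_curvature_eq_curvature:
  assumes "triangulates E F M" "\<forall>e\<in>E. I e \<ge> 0" "r \<in> Omega F I"
  shows "ext_curvature F I r = curvature F I r"
proof -
  have "at_vertex (gen_angle I r) i f = at_vertex (angle I r) i f" if "f \<in> F" "i \<in> f" for f i
  proof -
    obtain a b c where f: "f = {a, b, c}" "a \<noteq> b" "a \<noteq> c" "b \<noteq> c"
      using triangulated_faceE[OF assms(1,2) \<open>f \<in> F\<close>] by metis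
    obtain j k where jk: "f = {i, j, k}" "i \<noteq> j" "i \<noteq> k" "j \<noteq> k"
    proof -
      consider "i = a" | "i = b" | "i = c" using \<open>i \<in> f\<close> f(1) by blast
      then show ?thesis
      proof cases
        case 1
        then show ?thesis using f by (intro that[of b c]) auto
      next
        case 2
        then show ?thesis using f by (intro that[of a c]) auto
      next
        case 3
        then show ?thesis using f by (intro that[of a b]) auto
      qed
    qed
    have "strict_triangle (edge_length I r i j) (edge_length I r j k) (edge_length I r i k)"
      using assms(3) \<open>f \<in> F\<close> jk(1) by (auto simp: Omega_def)
    then have "gen_angle I r i j k = angle I r i j k"
      by (auto simp: gen_angle_def strict_triangle_def)
    then show ?thesis
      using jk by (simp add: at_vertex_eq gen_angle_commute angle_commute)
  qed
  then show ?thesis by (auto simp: ext_curvature_def curvature_def vec_eq_iff intro!: sum.cong)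
qed

lemma nondegenerate_if_ln_Omega:
  assumes "u \<in> ln_Omega F I" "{i, j, k} \<in> F"
  shows "nondegenerate I i j k u"
proof -
  have "strict_triangle (edge_length I (exp_vec u) i j) (edge_length I (exp_vec u) j k) (edge_length I (exp_vec u) i k)"
    using assms by (simp add: ln_Omega_def Omega_def)
  then show ?thesis
    unfolding nondegenerate_def edge_length_exp_vec strict_triangle_def by linarith
qed

lemma edge_length_scale: "s > 0 \<Longrightarrow> edge_length I (s *\<^sub>R r) i j = s * edge_length I r i j"
proof -
  assume "s > 0"
  have "edge_length I (s *\<^sub>R r) i j = sqrt (s\<^sup>2 * ((r $ i)\<^sup>2 + (r $ j)\<^sup>2 + 2 * r $ i * r $ j * I {i, j}))"
    by (simp add: edge_length_def power2_eq_square algebra_simps)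
  then show ?thesis using \<open>s > 0\<close> by (simp add: edge_length_def real_sqrt_mult)
qed

lemma angle_scale: "s > 0 \<Longrightarrow> angle I (s *\<^sub>R r) i j k = angle I r i j k"
proof -
  assume s: "s > 0"
  have "((s * b)\<^sup>2 + (s * c)\<^sup>2 - (s * a)\<^sup>2) / (2 * (s * b) * (s * c)) = (b\<^sup>2 + c\<^sup>2 - a\<^sup>2) / (2 * b * c)"
    for a b c :: real
  proof -
    have e: "(s * b)\<^sup>2 + (s * c)\<^sup>2 - (s * a)\<^sup>2 = s\<^sup>2 * (b\<^sup>2 + c\<^sup>2 - a\<^sup>2)"
      "2 * (s * b) * (s * c) = s\<^sup>2 * (2 * b * c)"
      by (simp_all add: power2_eq_square algebra_simps)
    show ?thesis unfolding e using s by simp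
  qed
  then show ?thesis unfolding angle_def inner_angle_def edge_length_scale[OF s] by simp
qed

text \<open>Adding \<open>c\<close> to all logarithmic radii is a homothety.\<close>

lemma realized_by_shift:
  assumes "realized_by F I Kbar u"
  shows "realized_by F I Kbar (\<chi> i. u $ i + c)"
proof -
  have e: "exp_vec (\<chi> i. u $ i + c) = exp c *\<^sub>R exp_vec u"
    by (simp add: exp_vec_def vec_eq_iff exp_add)
  have "strict_triangle (s * x) (s * y) (s * z) = strict_triangle x y z" if "s > 0" for s x y z :: real
    using that by (simp add: strict_triangle_def distrib_left[symmetric])
  then have "exp c *\<^sub>R exp_vec u \<in> Omega F I"
    using assms by (simp add: realized_by_def ln_Omega_def Omega_def edge_length_scale)
  moreover have "angle I (exp c *\<^sub>R exp_vec u) = angle I (exp_vec u)"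
    by (simp add: fun_eq_iff angle_scale)
  ultimately show ?thesis
    using assms by (simp add: realized_by_def ln_Omega_def e curvature_def)
qed

definition flow_field :: "'v::finite set set \<Rightarrow> ('v set \<Rightarrow> real) \<Rightarrow> real^'v \<Rightarrow> real^'v \<Rightarrow> real^'v" where
  "flow_field F I Kbar u = Kbar - ext_curvature F I (exp_vec u)"

lemma flow_field_eq: "flow_field F I Kbar u = (Kbar - (\<chi> i. 2 * pi)) + (\<Sum>f\<in>F. face_angles I u f)"
  by (simp add: flow_field_def ext_curvature_eq_face_angles)

lemma flow_field_dissipative:
  assumes "triangulates E F M" "\<forall>e\<in>E. I e \<ge> 0"
  shows "dissipative_vector_field (flow_field F I Kbar) (norm (Kbar - (\<chi> i. 2 * pi)) + real (card F) * (3 * pi))"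
proof
  note face = triangulated_faceE[OF assms]
  show "continuous_on UNIV (flow_field F I Kbar)"
    unfolding flow_field_eq
  proof (intro continuous_on_add continuous_on_const continuous_on_sum)
    fix f assume "f \<in> F"
    then show "continuous_on UNIV (\<lambda>u. face_angles I u f)"
      by (rule face) (simp add: continuous_face_angles)
  qed
  show "norm (flow_field F I Kbar u) \<le> norm (Kbar - (\<chi> i. 2 * pi)) + real (card F) * (3 * pi)" for u
  proof -
    have "norm (face_angles I u f) \<le> 3 * pi" if "f \<in> F" for f
      using that by (rule face) (simp add: norm_face_angles_le)
    then have "norm (\<Sum>f\<in>F. face_angles I u f) \<le> real (card F) * (3 * pi)"
      by (rule sum_norm_bound)
    then show ?thesis unfolding flow_field_eq by (intro norm_triangle_mono order_refl)
  qed
  show "(flow_field F I Kbar u - flow_field F I Kbar v) \<bullet> (u - v) \<le> 0" for u v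
  proof -
    have "(face_angles I u f - face_angles I v f) \<bullet> (u - v) \<le> 0" if "f \<in> F" for f
      using that by (rule face) (simp add: face_angles_antimonotone)
    then have "(\<Sum>f\<in>F. (face_angles I u f - face_angles I v f) \<bullet> (u - v)) \<le> 0"
      by (intro sum_nonpos)
    then show ?thesis
      by (simp add: flow_field_eq sum_subtractf[symmetric] inner_sum_left)
  qed
qed

lemma sum_flow_field:
  assumes "triangulates E F M" "\<forall>e\<in>E. I e \<ge> 0"
  shows "(\<Sum>i\<in>UNIV. flow_field F I Kbar u $ i) = (\<Sum>i\<in>UNIV. Kbar $ i - 2 * pi) + real (card F) * pi"
proof -
  have "(\<Sum>i\<in>UNIV. face_angles I u f $ i) = pi" if "f \<in> F" for f
    using that by (rule triangulated_faceE[OF assms]) (simp add: sum_face_angles)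
  then have "(\<Sum>f\<in>F. \<Sum>i\<in>UNIV. face_angles I u f $ i) = real (card F) * pi" by simp
  then show ?thesis
    by (simp add: flow_field_eq sum.distrib sum_component sum.swap[of _ _ F])
qed

text \<open>The form of the derivative is a sum of nonpositive terms, one per face. If it vanishes at \<open>w\<close>, then \<open>w\<close> is constant
  on each face, hence constant, hence zero by the normalization of its sum.\<close>

lemma flow_field_locally_stable:
  assumes T: "triangulates E F M" "\<forall>e\<in>E. I e \<ge> 0" and conn: "connected_space M"
    and a: "a \<in> ln_Omega F I" "flow_field F I Kbar a = 0"
  shows "\<exists>c>0. \<exists>\<delta>>0. \<forall>w\<in>{w. (\<Sum>i\<in>UNIV. w $ i) = 0}. norm w \<le> \<delta> \<longrightarrow>
     flow_field F I Kbar (a + w) \<bullet> w \<le> - c * (norm w)\<^sup>2"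
proof -
  have "\<exists>D. ((\<lambda>u. face_angles I u f) has_derivative D) (at a) \<and> (\<forall>w. D w \<bullet> w \<le> 0) \<and>
      (\<forall>w. D w \<bullet> w = 0 \<longrightarrow> (\<forall>i\<in>f. \<forall>j\<in>f. w $ i = w $ j))" if fF: "f \<in> F" for f
  proof -
    obtain i j k where f: "f = {i, j, k}" "i \<noteq> j" "i \<noteq> k" "j \<noteq> k" "nonneg_face I i j k"
      using triangulated_faceE[OF T fF] .
    have "nondegenerate I i j k a" using nondegenerate_if_ln_Omega[OF a(1)] fF unfolding f(1) by blast
    from face_angles_has_derivative[OF f(2-5) this] obtain D
      where "((\<lambda>u. face_angles I u {i, j, k}) has_derivative D) (at a)"
        "\<And>w. D w \<bullet> w \<le> 0" "\<And>w. D w \<bullet> w = 0 \<Longrightarrow> w $ i = w $ j \<and> w $ j = w $ k" by blast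
    then show ?thesis unfolding f(1) by (intro exI[of _ D]) auto
  qed
  then have "\<forall>f\<in>F. \<exists>D. ((\<lambda>u. face_angles I u f) has_derivative D) (at a) \<and> (\<forall>w. D w \<bullet> w \<le> 0) \<and>
      (\<forall>w. D w \<bullet> w = 0 \<longrightarrow> (\<forall>i\<in>f. \<forall>j\<in>f. w $ i = w $ j))" by blast
  from bchoice[OF this] obtain D where
    all: "\<forall>f\<in>F. ((\<lambda>u. face_angles I u f) has_derivative D f) (at a) \<and> (\<forall>w. D f w \<bullet> w \<le> 0) \<and>
      (\<forall>w. D f w \<bullet> w = 0 \<longrightarrow> (\<forall>i\<in>f. \<forall>j\<in>f. w $ i = w $ j))" ..
  have D: "((\<lambda>u. face_angles I u f) has_derivative D f) (at a)" "D f w \<bullet> w \<le> 0"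
    "D f w \<bullet> w = 0 \<Longrightarrow> i \<in> f \<Longrightarrow> j \<in> f \<Longrightarrow> w $ i = w $ j" if "f \<in> F" for f w i j
    using bspec[OF all that] by blast+
  show ?thesis
  proof (rule derivative_definite_imp_locally_stable[where D = "\<lambda>w. \<Sum>f\<in>F. D f w"])
    have "((\<lambda>u. (Kbar - (\<chi> i. 2 * pi)) + (\<Sum>f\<in>F. face_angles I u f)) has_derivative
        (\<lambda>w. 0 + (\<Sum>f\<in>F. D f w))) (at a)"
      by (intro has_derivative_add has_derivative_const has_derivative_sum D(1))
    then show "(flow_field F I Kbar has_derivative (\<lambda>w. \<Sum>f\<in>F. D f w)) (at a)"
      by (simp add: flow_field_eq[abs_def])
    show "subspace {w::real^'a. (\<Sum>i\<in>UNIV. w $ i) = 0}"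
      by (simp add: subspace_def sum.distrib sum_distrib_left[symmetric])
    show "(\<Sum>f\<in>F. D f w) \<bullet> w \<le> 0" for w
      unfolding inner_sum_left by (intro sum_nonpos D(2))
    show "w = 0" if w: "w \<in> {w. (\<Sum>i\<in>UNIV. w $ i) = 0}" "(\<Sum>f\<in>F. D f w) \<bullet> w = 0" for w
    proof -
      have "(\<Sum>f\<in>F. - (D f w \<bullet> w)) = 0" using w(2) by (simp add: inner_sum_left sum_negf)
      then have "\<forall>f\<in>F. - (D f w \<bullet> w) = 0"
        by (subst (asm) sum_nonneg_eq_0_iff) (use D(2) in auto)
      then have face_const: "w $ i = w $ j" if "f \<in> F" "i \<in> f" "j \<in> f" for f i j
        using D(3)[OF that(1) _ that(2,3), of w] that(1) by simp
      have const: "w $ i = w $ j" for i j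
        by (rule locally_constant_vector_is_constant[OF T(1) conn]) (rule face_const)
      have "w $ j = 0" for j
      proof -
        have "(\<Sum>i\<in>UNIV. w $ i) = (\<Sum>i\<in>(UNIV :: 'a set). w $ j)" by (intro sum.cong refl const)
        then show ?thesis using w(1) by simp
      qed
      then show ?thesis by (simp add: vec_eq_iff)
    qed
  qed (rule a(2))
qed

text \<open>The coordinate sum of the field is the same at all points, and it vanishes at the zero \<open>a\<close>.\<close>

lemma flow_sum_conserved:
  assumes T: "triangulates E F M" "\<forall>e\<in>E. I e \<ge> 0"
    and u: "\<And>t. t \<in> {0..} \<Longrightarrow> (u has_vector_derivative flow_field F I Kbar (u t)) (at t within {0..})"
    and a: "flow_field F I Kbar a = 0" and "t \<ge> 0"
  shows "(\<Sum>i\<in>UNIV. u t $ i) = (\<Sum>i\<in>UNIV. u 0 $ i)"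
proof -
  have "(\<Sum>i\<in>UNIV. flow_field F I Kbar x $ i) = (\<Sum>i\<in>UNIV. flow_field F I Kbar a $ i)" for x
    unfolding sum_flow_field[OF T] ..
  then have zero: "(\<Sum>i\<in>UNIV. flow_field F I Kbar x $ i) = 0" for x by (simp add: a)
  have lin: "bounded_linear (\<lambda>x::real^'a. \<Sum>i\<in>UNIV. x $ i)"
    by (intro bounded_linear_sum bounded_linear_vec_nth)
  have "((\<lambda>t. \<Sum>i\<in>UNIV. u t $ i) has_vector_derivative 0) (at s within {0..})" if "s \<in> {0..}" for s
    using bounded_linear.has_vector_derivative[OF lin u[OF that]] by (simp add: zero)
  then obtain c where "\<And>s. s \<in> {0..} \<Longrightarrow> (\<Sum>i\<in>UNIV. u s $ i) = c"
    using has_vector_derivative_zero_constant[of "{0::real..}" "\<lambda>t. \<Sum>i\<in>UNIV. u t $ i"] by auto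
  then show ?thesis using \<open>t \<ge> 0\<close> by simp
qed

lemma exp_converges_to_realization:
  assumes T: "triangulates E F M" "\<forall>e\<in>E. I e \<ge> 0" and conn: "connected_space M"
    and u: "flow_solution F I Kbar {0..} u"
    and a: "realized_by F I Kbar a" "(\<Sum>i\<in>UNIV. a $ i) = (\<Sum>i\<in>UNIV. u 0 $ i)"
  shows "exp_converges u a"
proof -
  interpret dissipative_vector_field "flow_field F I Kbar" "norm (Kbar - (\<chi> i. 2 * pi)) + real (card F) * (3 * pi)"
    by (rule flow_field_dissipative[OF T])
  have aO: "a \<in> ln_Omega F I" using a(1) by (simp add: realized_by_def)
  have zero: "flow_field F I Kbar a = 0"
    using a(1) ext_curvature_eq_curvature[OF T] by (simp add: realized_by_def ln_Omega_def flow_field_def)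
  have u': "(u has_vector_derivative flow_field F I Kbar (u t)) (at t within {0..})" if "t \<in> {0..}" for t
    using u that by (simp add: flow_solution_def flow_field_def)
  obtain c \<delta> where "c > 0" "\<delta> > 0" and st:
    "\<And>w. w \<in> {w. (\<Sum>i\<in>UNIV. w $ i) = 0} \<Longrightarrow> norm w \<le> \<delta> \<Longrightarrow> flow_field F I Kbar (a + w) \<bullet> w \<le> - c * (norm w)\<^sup>2"
    using flow_field_locally_stable[OF T conn aO zero] by blast
  show ?thesis unfolding exp_converges_def
  proof (rule exponential_decay_to_stable_zero[OF u' _ _ zero \<open>c > 0\<close> \<open>\<delta> > 0\<close> st])
    show "subspace {w::real^'a. (\<Sum>i\<in>UNIV. w $ i) = 0}"
      by (simp add: subspace_def sum.distrib sum_distrib_left[symmetric])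
    show "u t - a \<in> {w. (\<Sum>i\<in>UNIV. w $ i) = 0}" if "t \<ge> 0" for t
      using flow_sum_conserved[OF T u' zero that] a(2) by (simp add: sum_subtractf)
  qed
qed

theorem theorem4p3:
  fixes M :: "'m topology"
    and E F :: "'v::finite set set"
    and I :: "'v set \<Rightarrow> real"
    and Kbar :: "real^'v"
  assumes "closed_surface M" and "connected_space M"
    and "triangulates E F M"
    and "\<forall>e\<in>E. I e \<ge> 0"
  shows
    "(\<forall>u0. \<exists>u. u 0 = u0 \<and> flow_solution F I Kbar {0..} u) \<and>
     (\<forall>T>0. \<forall>v. flow_solution F I Kbar {0..<T} v \<longrightarrow>
        (\<exists>u. flow_solution F I Kbar {0..} u \<and> (\<forall>t\<in>{0..<T}. u t = v t))) \<and>
     (\<forall>u ubar. flow_solution F I Kbar {0..} u \<and> (u \<longlongrightarrow> ubar) at_top \<longrightarrow>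
        Kbar = ext_curvature F I (exp_vec ubar) \<and>
        (ubar \<in> ln_Omega F I \<longrightarrow> admissible F I Kbar \<and> realized_by F I Kbar ubar)) \<and>
     (\<forall>u ubar. flow_solution F I Kbar {0..} u \<and> admissible F I Kbar \<and> realized_by F I Kbar ubar \<longrightarrow>
        (\<exists>c. realized_by F I Kbar (\<chi> i. ubar $ i + c) \<and> exp_converges u (\<chi> i. ubar $ i + c)) \<and>
        ((\<Sum>i\<in>UNIV. ubar $ i) = (\<Sum>i\<in>UNIV. u 0 $ i) \<longrightarrow> exp_converges u ubar))"
proof -
  note T = assms(3,4)
  let ?G = "flow_field F I Kbar"
  interpret dissipative_vector_field ?G "norm (Kbar - (\<chi> i. 2 * pi)) + real (card F) * (3 * pi)"
    by (rule flow_field_dissipative[OF T])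
  have sol: "flow_solution F I Kbar J u \<longleftrightarrow> (\<forall>t\<in>J. (u has_vector_derivative ?G (u t)) (at t within J))"
    for J u by (simp add: flow_solution_def flow_field_def)
  have ex: "\<exists>u. u 0 = u0 \<and> flow_solution F I Kbar {0..} u" for u0
    using global_solution_exists[of u0] unfolding sol .
  have ext: "\<exists>u. flow_solution F I Kbar {0..} u \<and> (\<forall>t\<in>{0..<T}. u t = v t)"
    if v: "flow_solution F I Kbar {0..<T} v" for T v
  proof -
    obtain u where u: "u 0 = v 0" "flow_solution F I Kbar {0..} u" using ex by blast
    have "(u has_vector_derivative ?G (u t)) (at t within {0..<T})" if "t \<in> {0..<T}" for t
    proof (rule has_vector_derivative_within_subset)
      show "(u has_vector_derivative ?G (u t)) (at t within {0..})" using u(2) that unfolding sol by simp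
    qed auto
    then have "u t = v t" if "t \<in> {0..<T}" for t
      using solution_unique[of T u v t] v u(1) that unfolding sol by blast
    then show ?thesis using u(2) by blast
  qed
  have lim: "Kbar = ext_curvature F I (exp_vec ubar) \<and>
        (ubar \<in> ln_Omega F I \<longrightarrow> admissible F I Kbar \<and> realized_by F I Kbar ubar)"
    if u: "flow_solution F I Kbar {0..} u" "(u \<longlongrightarrow> ubar) at_top" for u ubar
  proof -
    have "?G ubar = 0"
      using flow_limit_is_zero[OF cont _ u(2)] u(1) unfolding sol by blast
    then have K: "Kbar = ext_curvature F I (exp_vec ubar)" by (simp add: flow_field_def)
    moreover have "Kbar = curvature F I (exp_vec ubar)" "exp_vec ubar \<in> Omega F I" if "ubar \<in> ln_Omega F I"
      using K that ext_curvature_eq_curvature[OF T] by (simp_all add: ln_Omega_def)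
    ultimately show ?thesis by (auto simp: admissible_def realized_by_def)
  qed
  have conv: "(\<exists>c. realized_by F I Kbar (\<chi> i. ubar $ i + c) \<and> exp_converges u (\<chi> i. ubar $ i + c)) \<and>
        ((\<Sum>i\<in>UNIV. ubar $ i) = (\<Sum>i\<in>UNIV. u 0 $ i) \<longrightarrow> exp_converges u ubar)"
    if u: "flow_solution F I Kbar {0..} u" and r: "realized_by F I Kbar ubar" for u ubar
  proof -
    \<comment> \<open>The shift that gives the realization the conserved coordinate sum of the flow.\<close>
    define c where "c = ((\<Sum>i\<in>UNIV. u 0 $ i) - (\<Sum>i\<in>UNIV. ubar $ i)) / real CARD('v)"
    have "(\<Sum>i\<in>UNIV. (\<chi> i. ubar $ i + c) $ i) = (\<Sum>i\<in>UNIV. u 0 $ i)"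
      by (simp add: sum.distrib c_def)
    then have "exp_converges u (\<chi> i. ubar $ i + c)"
      by (rule exp_converges_to_realization[OF T assms(2) u realized_by_shift[OF r]])
    then show ?thesis
      using realized_by_shift[OF r] exp_converges_to_realization[OF T assms(2) u r] by blast
  qed
  show ?thesis using ex ext lim conv by blast
qed

end
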